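(* $\mathcal L_{\mathsf{Canco}}\preceq\mathcal L_{\mathsf{Hasco}}\preceq\mathcal L_{\mathsf{Eq}}\preceq\mathcal L_{\mathsf{Canco}}$, where for logics $\mathcal L_1,\mathcal L_2$ the relation $\mathcal L_1\preceq\mathcal L_2$ means that for all $TCCS^m$ processes $P,Q$, $\mathcal L_2(P)=\mathcal L_2(Q)$ implies $\mathcal L_1(P)=\mathcal L_1(Q)$.
   Context: LANGUAGE. $\mathsf{Act}$ is an infinite set of actions with CCS complementation ($\bar{\bar a}=a$); $\tau\notin\mathsf{Act}$; $\mu$ ranges over $\mathsf{Act}\cup\{\tau\}$. Transaction names: $\mathsf{TrN}=\mathsf{inTrN}\uplus\mathsf{exTrN}$ (internal and external names, both infinite). Terms: $P,Q::=\sum_{i\in J}\mu_i.P_i$ ($J$ countable; $\mathbf 0$ is the empty sum) $\mid P\mid Q\mid\nu a.P\mid X\mid\mathrm{rec}X.P\mid[\![P\triangleright_kQ]\!]$ (running transaction named $k$) $\mid\mathrm{co}\mid[\![P\blacktriangleright Q]\!]$ (dormant transaction). $ftn(o)$ is the set of transaction names in $o$; $o\,\sharp\,o'$ means no transaction name of $o$ occurs in $o'$. A process is a well-formed term: (1) it is closed (no free process variables); (2) $ftn$ of it is finite; and for all subterms $[\![P_1\triangleright_kP_1']\!]$, $[\![P_2\blacktriangleright P_2']\!]$, $\sum\mu_i.Q_i$, $\mathrm{rec}X.R$: (3) $P_1,P_1',P_2,P_2',Q_i,R$ contain no transaction names; (4) $P_1,P_2,Q_i$ contain no dormant transactions; (5)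 $P_1,P_2$ are closed. PROCESS TRANSITIONS. $P\xrightarrow{\alpha}_\sigma Q$ with $\alpha\in\{a,\tau,k(\tau),k(a)\}$ and $\sigma$ a name substitution $\tilde k\mapsto l$ (domain the finite tuple $\tilde k$, possibly empty, range $\{l\}$; $\varepsilon$ alone is the empty substitution). Rules (symmetric ones omitted): - $\sum\mu_i.P_i\xrightarrow{\mu_j}_\varepsilon P_j$; - if $P\xrightarrow{a}_\varepsilon P'$ and $Q\xrightarrow{\bar a}_\varepsilon Q'$ then $P\mid Q\xrightarrow{\tau}_\varepsilon P'\mid Q'$; - $\mathrm{rec}X.P\xrightarrow{\tau}_\varepsilon P[\mathrm{rec}X.P/X]$; - if $\mu_j=a$ then $\sum\mu_i.P_i\xrightarrow{k(a)}_{\varepsilon\mapsto k}[\![P_j\mid\mathrm{co}\triangleright_k\sum\mu_i.P_i]\!]$; - if $P\xrightarrow{\mu}_\varepsilon P'$ and $k\,\sharp\,l$ then $[\![P\triangleright_lQ]\!]\xrightarrow{k(\mu)}_{l\mapsto k}[\![P'\triangleright_kQ]\!]$; - if $P\xrightarrow{k(a)}_{\sigma_1}P'$, $Q\xrightarrow{k(\bar a)}_{\sigma_2}Q'$, $\sigma_i=\tilde l_i\mapsto k$, then $P\mid Q\xrightarrow{k(\tau)}_{(\tilde l_1,\tilde l_2)\mapsto k}P'\sigma_2\mid Q'\sigma_1$; - if $P\xrightarrow{\alpha}_\sigma P'$ and $range(\sigma)\,\sharp\,Q$ then $P\mid Q\xrightarrow{\alpha}_\sigma P'\mid Q\sigma$;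 - if $P\xrightarrow{\alpha}_\sigma P'$ and $a$ does not occur in $\alpha$ then $\nu a.P\xrightarrow{\alpha}_\sigma\nu a.P'$. Reconfiguration transitions $P\xrightarrow{\beta}Q$, $\beta\in\{\mathrm{co}\,k,\mathrm{ab}\,k,\mathrm{new}\,k\}$ (symmetric rules omitted): - if $P\equiv\mathrm{co}\mid P''$ for some $P''$ and $P\rightsquigarrow_{\mathrm{co}}P'$ then $[\![P\triangleright_kQ]\!]\xrightarrow{\mathrm{co}\,k}P'$; - $[\![P\blacktriangleright Q]\!]\xrightarrow{\mathrm{new}\,k}[\![P\triangleright_kQ]\!]$; - $[\![P\triangleright_kQ]\!]\xrightarrow{\mathrm{ab}\,k}Q$; - for $\beta=\mathrm{co}\,k$ or $\mathrm{ab}\,k$: if $P\xrightarrow{\beta}P'$ and $Q\xrightarrow{\beta}Q'$ then $P\mid Q\xrightarrow{\beta}P'\mid Q'$; - if $P\xrightarrow{\beta}P'$ and $\beta\,\sharp\,Q$ then $P\mid Q\xrightarrow{\beta}P'\mid Q$; - if $P\xrightarrow{\beta}P'$ then $\nu a.P\xrightarrow{\beta}\nu a.P'$. Here $\equiv$ is standard CCS structural equivalence extended to transactions, and $\rightsquigarrow_{\mathrm{co}}$ is given by: $\mathrm{co}\rightsquigarrow_{\mathrm{co}}\mathbf 0$; sums, variables, $\mathrm{rec}X.P$ and $[\![P\blacktriangleright Q]\!]$ are related to themselves; it is compatible with $\nu a.-$ and $-\mid-$. EXTENDED CONFIGURATIONS. $I$ is a countable index set. An extended configuration is $\langle E;H\bullet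 P\rangle$ with $P$ a process, $E$ an equivalence relation over a finite subset of $\mathsf{TrN}$, and $H$ a finite partial function from $I$ to $\{k(a),k(\mathrm{ab}),k(\mathrm{co})\mid k\in\mathsf{exTrN},a\in\mathsf{Act}\}$. Let $H^{\mathrm{trn}}(i)$ be the name used in $H(i)$, $H^{\mathrm{trn}}$ the set of all these, and $\mathrm{Hasco}(H)=\{k\mid\exists i.\,H(i)=k(\mathrm{co})\}$. It is required that: (i) $H^{\mathrm{trn}}(i)=H^{\mathrm{trn}}(j)$ implies $i=j$; (ii) for $k\in\mathsf{exTrN}$, $k\,E\,k$ iff $k\in H^{\mathrm{trn}}$, and $k\,E\,k'$ implies ($k\in\mathrm{Hasco}(H)$ iff $k'\in\mathrm{Hasco}(H)$); (iii) $ftn(P)\cap\mathrm{Hasco}(H)=\emptyset$; (iv) $k\,E\,k'$ and $k,k'\in ftn(P)$ imply $k=k'$. Convention: external names of a configuration are those in its history, i.e. $ftn(P)\cap\mathsf{exTrN}\subseteq H^{\mathrm{trn}}$; in particular a process $P$ viewed as $\langle\emptyset;\varepsilon\bullet P\rangle$ ($\varepsilon$ the empty history) has $ftn(P)\subseteq\mathsf{inTrN}$. "$H,k(a)$" denotes $H$ extended at a new index. For $\sigma=\tilde k\mapsto l$, $\sigma(E)$ is the smallest equivalence relation $F\supseteq E$ with $l\,F\,l$ and $k\,F\,l$ for all $k\in dom(\sigma)$. $(E;H)\setminus_{\mathrm{co}}k$ (resp. $\setminus_{\mathrm{ab}}k$) keeps $E$ and, for every $k'\,E\,k$, changes each $k'(a)$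 in $H$ to $k'(\mathrm{co})$ (resp. $k'(\mathrm{ab})$). With $\Delta=E;H$, the extended transitions between extended configurations are: - $\langle\Delta\bullet P\rangle\xrightarrow{\tau}_e\langle\Delta\bullet Q\rangle$ if $P\xrightarrow{\tau}_\varepsilon Q$; - $\xrightarrow{\tau}_e\langle\sigma(E);H\bullet Q\rangle$ if $P\xrightarrow{k(\tau)}_\sigma Q$, $k\,\sharp\,E,H$, $k\in\mathsf{inTrN}$; - $\xrightarrow{\tau}_e\langle\Delta\bullet Q\rangle$ if $P\xrightarrow{\mathrm{new}\,k}Q$, $k\,\sharp\,\Delta$, $k\in\mathsf{inTrN}$; - $\xrightarrow{\tau}_e\langle\Delta\setminus_{\mathrm{co}}k\bullet Q\rangle$ if $P\xrightarrow{\mathrm{co}\,k}Q$; - $\xrightarrow{\tau}_e\langle\Delta\setminus_{\mathrm{ab}}k\bullet Q\rangle$ if $P\xrightarrow{\mathrm{ab}\,k}Q$; - $\xrightarrow{k(a)}_e\langle\sigma(E);H,k(a)\bullet Q\rangle$ if $P\xrightarrow{k(a)}_\sigma Q$, $k\,\sharp\,E,H$, $k\in\mathsf{exTrN}$; - $\xrightarrow{k(a)}_e\langle E,(k,k);H,k(\mathrm{ab})\bullet P\rangle$ if $k\,\sharp\,E,H,P$, $k\in\mathsf{exTrN}$. The commit-sensitive transitions $\xrightarrow{\zeta}_c$ are given by the same rules (with $_c$ for $_e$), except that the commit rule is replaced, with $E_{ext}(k)=\{k'\in\mathsf{exTrN}\mid k\,E\,k'\}$, by: $\langle\Delta\bullet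 P\rangle\xrightarrow{\mathrm{co}(E_{ext}(k))}_c\langle\Delta\setminus_{\mathrm{co}}k\bullet Q\rangle$ if $P\xrightarrow{\mathrm{co}\,k}Q$ and $E_{ext}(k)\neq\emptyset$; and $\langle\Delta\bullet P\rangle\xrightarrow{\tau}_c\langle\Delta\setminus_{\mathrm{co}}k\bullet Q\rangle$ if $P\xrightarrow{\mathrm{co}\,k}Q$ and $E_{ext}(k)=\emptyset$. For $s\in\{e,c\}$, $\stackrel{\tau}{\Rightarrow}_s$ is $(\xrightarrow{\tau}_s)^*$ and $\stackrel{\zeta}{\Rightarrow}_s$ is $\stackrel{\tau}{\Rightarrow}_s\xrightarrow{\zeta}_s\stackrel{\tau}{\Rightarrow}_s$ otherwise. LOGICS. $\mathsf{Var}$ is a countable set of variables disjoint from $\mathsf{exTrN}$. All three logics have formulae $\langle\tau\rangle\phi$, $\langle x(a)\rangle\phi$ ($x\in\mathsf{Var}$, bound in $\phi$; $a\in\mathsf{Act}$), $\neg\phi$, $\bigwedge_{i\in M}\phi_i$ ($M$ an arbitrary index set), plus: in $\mathcal L_{\mathsf{Hasco}}$, $\mathtt{Hasco}(v)$; in $\mathcal L_{\mathsf{Eq}}$, $v_1=_{\mathrm{co}}v_2$; in $\mathcal L_{\mathsf{Canco}}$, $\langle\mathrm{co}(K)\rangle\phi$ with $\emptyset\neq K\subseteq\mathsf{exTrN}\uplus\mathsf{Var}$; here $v,v_1,v_2\in\mathsf{exTrN}\cup\mathsf{Var}$. Closed formulae have no free variables. Satisfaction of closed formulae by extended configurations, with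 $s=e$ for $\mathcal L_{\mathsf{Hasco}},\mathcal L_{\mathsf{Eq}}$ and $s=c$ for $\mathcal L_{\mathsf{Canco}}$: $\mathcal C\models\langle\tau\rangle\phi$ iff $\mathcal C\stackrel{\tau}{\Rightarrow}_s\mathcal C'\models\phi$ for some $\mathcal C'$; $\mathcal C\models\langle x(a)\rangle\phi$ iff there is a cofinite $N\subseteq\mathsf{exTrN}$ such that for all $l\in N$ there is $\mathcal C'$ with $\mathcal C\stackrel{l(a)}{\Rightarrow}_s\mathcal C'$ and $\mathcal C'\models\phi[l/x]$; conjunction and negation are standard; and, for $\mathcal C=\langle E;H\bullet P\rangle$: $\mathcal C\models\mathtt{Hasco}(k)$ iff $k\in\mathrm{Hasco}(H)$; $\mathcal C\models k=_{\mathrm{co}}k'$ iff $k,k'\in\mathrm{Hasco}(H)$ and $k\,E\,k'$; $\mathcal C\models\langle\mathrm{co}(K)\rangle\phi$ iff $\mathcal C\stackrel{\mathrm{co}(K)}{\Rightarrow}_c\mathcal C'\models\phi$ for some $\mathcal C'$. For a logic $\mathcal L$ and process $P$, $\mathcal L(P)$ is the set of closed formulae of $\mathcal L$ satisfied by $\langle\emptyset;\varepsilon\bullet P\rangle$. *)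

theory Defs
  imports Main "HOL-Library.Infinite_Typeclass"
begin

section \<open>Terms\<close>

text \<open>
  Terms are taken up to alpha-conversion, so the binders \<open>\<nu>\<close> and \<open>rec\<close> use de Bruijn indices:
  \<open>Bnd n\<close> (resp. \<open>PVar n\<close>) refers to the \<open>n\<close>-th enclosing \<open>\<nu>\<close> (resp. \<open>rec\<close>). For channels, named
  binders would not do: a countable sum may use every channel, so that no fresh one need exist.
  The set of actions is \<open>'c act\<close>: names and co-names over the infinite set \<open>'c\<close> of channels.
\<close>

datatype 'c chan = Free 'c | Bnd nat

datatype 'x act = In 'x | Out 'x

primrec bar :: "'x act \<Rightarrow> 'x act" where
  "bar (In x) = Out x"
| "bar (Out x) = In x"

datatype 'x pre = Tau | Act "'x act"

text \<open>
  \<open>Choice F\<close> is the sum of the \<open>\<mu>\<^sub>i.P\<^sub>i\<close> with \<open>F i = Some (\<mu>\<^sub>i, P\<^sub>i)\<close>; the countable index set is \<open>dom F\<close>.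
  \<open>Run P k Q\<close> is the running transaction \<open>P \<triangleright>\<^sub>k Q\<close>, \<open>Dorm P Q\<close> the dormant one. The set function
  \<open>ftn\<close> yields the transaction names of a term, \<open>map_trm\<close> renames them.
\<close>

datatype (dead 'c, ftn: 'k) trm =
    Choice "nat \<Rightarrow> ('c chan pre \<times> ('c, 'k) trm) option"
  | Par "('c, 'k) trm" "('c, 'k) trm"
  | Nu "('c, 'k) trm"
  | PVar nat
  | Rec "('c, 'k) trm"
  | Run "('c, 'k) trm" 'k "('c, 'k) trm"
  | Co
  | Dorm "('c, 'k) trm" "('c, 'k) trm"
  for map: map_trm

definition Zero :: "('c, 'k) trm" where
  "Zero = Choice Map.empty"

primrec shc :: "'c chan \<Rightarrow> 'c chan" where
  "shc (Free a) = Free a"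
| "shc (Bnd n) = Bnd (Suc n)"

definition upr :: "('c chan \<Rightarrow> 'c chan) \<Rightarrow> 'c chan \<Rightarrow> 'c chan" where
  "upr r c = (case c of Free a \<Rightarrow> shc (r (Free a))
                      | Bnd 0 \<Rightarrow> Bnd 0
                      | Bnd (Suc n) \<Rightarrow> shc (r (Bnd n)))"

primrec ren :: "('c, 'k) trm \<Rightarrow> ('c chan \<Rightarrow> 'c chan) \<Rightarrow> ('c, 'k) trm" where
  "ren (Choice F) r = Choice (\<lambda>i. map_option (map_prod (map_pre r) (\<lambda>P. ren P r)) (F i))"
| "ren (Par P Q) r = Par (ren P r) (ren Q r)"
| "ren (Nu P) r = Nu (ren P (upr r))"
| "ren (PVar n) r = PVar n"
| "ren (Rec P) r = Rec (ren P r)"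
| "ren (Run P k Q) r = Run (ren P r) k (ren Q r)"
| "ren Co r = Co"
| "ren (Dorm P Q) r = Dorm (ren P r) (ren Q r)"

definition lift :: "('c, 'k) trm \<Rightarrow> ('c, 'k) trm" where
  "lift P = ren P shc"

text \<open>
  \<open>subst P n R\<close> replaces process variable \<open>n\<close> of \<open>P\<close> by \<open>R\<close>, without capture of channels. It is only
  meant for \<open>R\<close> without free process variables, so these need no lifting under \<open>Rec\<close>.
\<close>

primrec subst :: "('c, 'k) trm \<Rightarrow> nat \<Rightarrow> ('c, 'k) trm \<Rightarrow> ('c, 'k) trm" where
  "subst (Choice F) n R = Choice (\<lambda>i. map_option (map_prod id (\<lambda>P. subst P n R)) (F i))"
| "subst (Par P Q) n R = Par (subst P n R) (subst Q n R)"
| "subst (Nu P) n R = Nu (subst P n (lift R))"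
| "subst (PVar m) n R = (if m = n then R else PVar m)"
| "subst (Rec P) n R = Rec (subst P (Suc n) R)"
| "subst (Run P k Q) n R = Run (subst P n R) k (subst Q n R)"
| "subst Co n R = Co"
| "subst (Dorm P Q) n R = Dorm (subst P n R) (subst Q n R)"


section \<open>Processes\<close>

inductive subterm :: "('c, 'k) trm \<Rightarrow> ('c, 'k) trm \<Rightarrow> bool" where
  "subterm P P"
| "F i = Some (\<mu>, P) \<Longrightarrow> subterm R P \<Longrightarrow> subterm R (Choice F)"
| "subterm R P \<Longrightarrow> subterm R (Par P Q)"
| "subterm R Q \<Longrightarrow> subterm R (Par P Q)"
| "subterm R P \<Longrightarrow> subterm R (Nu P)"
| "subterm R P \<Longrightarrow> subterm R (Rec P)"
| "subterm R P \<Longrightarrow> subterm R (Run P k Q)"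
| "subterm R Q \<Longrightarrow> subterm R (Run P k Q)"
| "subterm R P \<Longrightarrow> subterm R (Dorm P Q)"
| "subterm R Q \<Longrightarrow> subterm R (Dorm P Q)"

text \<open>\<open>pclosed n P\<close>: all free process variables of \<open>P\<close> are below \<open>n\<close>.\<close>

inductive pclosed :: "nat \<Rightarrow> ('c, 'k) trm \<Rightarrow> bool" where
  "(\<And>i \<mu> P. F i = Some (\<mu>, P) \<Longrightarrow> pclosed n P) \<Longrightarrow> pclosed n (Choice F)"
| "pclosed n P \<Longrightarrow> pclosed n Q \<Longrightarrow> pclosed n (Par P Q)"
| "pclosed n P \<Longrightarrow> pclosed n (Nu P)"
| "m < n \<Longrightarrow> pclosed n (PVar m)"
| "pclosed (Suc n) P \<Longrightarrow> pclosed n (Rec P)"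
| "pclosed n P \<Longrightarrow> pclosed n Q \<Longrightarrow> pclosed n (Run P k Q)"
| "pclosed n Co"
| "pclosed n P \<Longrightarrow> pclosed n Q \<Longrightarrow> pclosed n (Dorm P Q)"

text \<open>
  \<open>cclosed n P\<close>: all dangling channel indices of \<open>P\<close> are below \<open>n\<close>. The terms of the calculus are
  those with \<open>cclosed 0\<close>; their free channels are all of the form \<open>Free a\<close>.
\<close>

inductive cclosed :: "nat \<Rightarrow> ('c, 'k) trm \<Rightarrow> bool" where
  "(\<And>i \<mu> P. F i = Some (\<mu>, P) \<Longrightarrow> (\<forall>m. Bnd m \<in> set_pre \<mu> \<longrightarrow> m < n) \<and> cclosed n P)
    \<Longrightarrow> cclosed n (Choice F)"
| "cclosed n P \<Longrightarrow> cclosed n Q \<Longrightarrow> cclosed n (Par P Q)"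
| "cclosed (Suc n) P \<Longrightarrow> cclosed n (Nu P)"
| "cclosed n (PVar m)"
| "cclosed n P \<Longrightarrow> cclosed n (Rec P)"
| "cclosed n P \<Longrightarrow> cclosed n Q \<Longrightarrow> cclosed n (Run P k Q)"
| "cclosed n Co"
| "cclosed n P \<Longrightarrow> cclosed n Q \<Longrightarrow> cclosed n (Dorm P Q)"

definition no_dorm :: "('c, 'k) trm \<Rightarrow> bool" where
  "no_dorm P \<longleftrightarrow> (\<forall>P1 P2. \<not> subterm (Dorm P1 P2) P)"

definition process :: "('c, 'k) trm \<Rightarrow> bool" where
  "process P \<longleftrightarrow>
     cclosed 0 P \<and> pclosed 0 P \<and> finite (ftn P) \<and>
     (\<forall>P1 k P1'. subterm (Run P1 k P1') P \<longrightarrow>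
        ftn P1 = {} \<and> ftn P1' = {} \<and> no_dorm P1 \<and> pclosed 0 P1) \<and>
     (\<forall>P2 P2'. subterm (Dorm P2 P2') P \<longrightarrow>
        ftn P2 = {} \<and> ftn P2' = {} \<and> no_dorm P2 \<and> pclosed 0 P2) \<and>
     (\<forall>F i \<mu> Q. subterm (Choice F) P \<and> F i = Some (\<mu>, Q) \<longrightarrow> ftn Q = {} \<and> no_dorm Q) \<and>
     (\<forall>R. subterm (Rec R) P \<longrightarrow> ftn R = {})"


section \<open>Process transitions\<close>

datatype (dead 'x, dead 'k) lab = Plain "'x pre" | Named 'k "'x pre"

primrec shl :: "('c chan, 'k) lab \<Rightarrow> ('c chan, 'k) lab" where
  "shl (Plain \<mu>) = Plain (map_pre shc \<mu>)"
| "shl (Named k \<mu>) = Named k (map_pre shc \<mu>)"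

text \<open>
  \<open>Eps\<close> is the empty substitution, \<open>Maps ks l\<close> is \<open>ks \<mapsto> l\<close>. \<open>Maps [] l\<close> has empty domain but, unlike
  \<open>Eps\<close>, range \<open>{l}\<close>.
\<close>

datatype 'k nsub = Eps | Maps "'k list" 'k

primrec sdom :: "'k nsub \<Rightarrow> 'k set" where
  "sdom Eps = {}"
| "sdom (Maps ks l) = set ks"

primrec srange :: "'k nsub \<Rightarrow> 'k set" where
  "srange Eps = {}"
| "srange (Maps ks l) = {l}"

primrec sapp :: "'k nsub \<Rightarrow> 'k \<Rightarrow> 'k" where
  "sapp Eps k = k"
| "sapp (Maps ks l) k = (if k \<in> set ks then l else k)"

abbreviation tsub :: "('c, 'k) trm \<Rightarrow> 'k nsub \<Rightarrow> ('c, 'k) trm" where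
  "tsub P \<sigma> \<equiv> map_trm (sapp \<sigma>) P"

text \<open>
  In the rule for \<open>Nu\<close>, the premise label \<open>shl \<alpha>\<close> ranges over the labels in which the restricted
  channel \<open>Bnd 0\<close> does not occur.
\<close>

inductive ptrans ::
  "('c, 'k) trm \<Rightarrow> ('c chan, 'k) lab \<Rightarrow> 'k nsub \<Rightarrow> ('c, 'k) trm \<Rightarrow> bool" where
  sum: "F j = Some (\<mu>, P) \<Longrightarrow> ptrans (Choice F) (Plain \<mu>) Eps P"
| com: "ptrans P (Plain (Act a)) Eps P' \<Longrightarrow> ptrans Q (Plain (Act (bar a))) Eps Q'
    \<Longrightarrow> ptrans (Par P Q) (Plain Tau) Eps (Par P' Q')"
| unfold: "ptrans (Rec P) (Plain Tau) Eps (subst P 0 (Rec P))"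
| sum_embed: "F j = Some (Act a, P)
    \<Longrightarrow> ptrans (Choice F) (Named k (Act a)) (Maps [] k) (Run (Par P Co) k (Choice F))"
| run: "ptrans P (Plain \<mu>) Eps P' \<Longrightarrow> k \<noteq> l
    \<Longrightarrow> ptrans (Run P l Q) (Named k \<mu>) (Maps [l] k) (Run P' k Q)"
| com_named: "ptrans P (Named k (Act a)) \<sigma>1 P' \<Longrightarrow> ptrans Q (Named k (Act (bar a))) \<sigma>2 Q'
    \<Longrightarrow> \<sigma>1 = Maps ls1 k \<Longrightarrow> \<sigma>2 = Maps ls2 k
    \<Longrightarrow> ptrans (Par P Q) (Named k Tau) (Maps (ls1 @ ls2) k) (Par (tsub P' \<sigma>2) (tsub Q' \<sigma>1))"
| parL: "ptrans P \<alpha> \<sigma> P' \<Longrightarrow> srange \<sigma> \<inter> ftn Q = {}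
    \<Longrightarrow> ptrans (Par P Q) \<alpha> \<sigma> (Par P' (tsub Q \<sigma>))"
| parR: "ptrans P \<alpha> \<sigma> P' \<Longrightarrow> srange \<sigma> \<inter> ftn Q = {}
    \<Longrightarrow> ptrans (Par Q P) \<alpha> \<sigma> (Par (tsub Q \<sigma>) P')"
| nu: "ptrans P (shl \<alpha>) \<sigma> P' \<Longrightarrow> ptrans (Nu P) \<alpha> \<sigma> (Nu P')"


section \<open>Reconfiguration transitions\<close>

primrec swap01 :: "'c chan \<Rightarrow> 'c chan" where
  "swap01 (Free a) = Free a"
| "swap01 (Bnd n) = Bnd (if n = 0 then 1 else if n = 1 then 0 else n)"

text \<open>
  Structural equivalence is a congruence for all operators, including the transactions. It does not
  unfold recursion, which costs a transition. Rule \<open>reindex\<close> makes sums independent of the encoding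
  of their index set.
\<close>

inductive sc :: "('c, 'k) trm \<Rightarrow> ('c, 'k) trm \<Rightarrow> bool" (infix "\<equiv>\<^sub>s" 50) where
  refl: "P \<equiv>\<^sub>s P"
| sym: "P \<equiv>\<^sub>s Q \<Longrightarrow> Q \<equiv>\<^sub>s P"
| trans: "P \<equiv>\<^sub>s Q \<Longrightarrow> Q \<equiv>\<^sub>s R \<Longrightarrow> P \<equiv>\<^sub>s R"
| par_zero: "Par P Zero \<equiv>\<^sub>s P"
| par_comm: "Par P Q \<equiv>\<^sub>s Par Q P"
| par_assoc: "Par (Par P Q) R \<equiv>\<^sub>s Par P (Par Q R)"
| nu_zero: "Nu Zero \<equiv>\<^sub>s Zero"
| nu_swap: "Nu (Nu P) \<equiv>\<^sub>s Nu (Nu (ren P swap01))"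
| nu_par: "Par (Nu P) Q \<equiv>\<^sub>s Nu (Par P (lift Q))"
| reindex: "bij_betw \<pi> (dom F) (dom G) \<Longrightarrow> (\<And>i. i \<in> dom F \<Longrightarrow> G (\<pi> i) = F i)
    \<Longrightarrow> Choice F \<equiv>\<^sub>s Choice G"
| cong_choice: "dom F = dom G
    \<Longrightarrow> (\<And>i \<mu> P. F i = Some (\<mu>, P) \<Longrightarrow> \<exists>Q. G i = Some (\<mu>, Q) \<and> P \<equiv>\<^sub>s Q)
    \<Longrightarrow> Choice F \<equiv>\<^sub>s Choice G"
| cong_par: "P \<equiv>\<^sub>s P' \<Longrightarrow> Q \<equiv>\<^sub>s Q' \<Longrightarrow> Par P Q \<equiv>\<^sub>s Par P' Q'"
| cong_nu: "P \<equiv>\<^sub>s P' \<Longrightarrow> Nu P \<equiv>\<^sub>s Nu P'"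
| cong_rec: "P \<equiv>\<^sub>s P' \<Longrightarrow> Rec P \<equiv>\<^sub>s Rec P'"
| cong_run: "P \<equiv>\<^sub>s P' \<Longrightarrow> Q \<equiv>\<^sub>s Q' \<Longrightarrow> Run P k Q \<equiv>\<^sub>s Run P' k Q'"
| cong_dorm: "P \<equiv>\<^sub>s P' \<Longrightarrow> Q \<equiv>\<^sub>s Q' \<Longrightarrow> Dorm P Q \<equiv>\<^sub>s Dorm P' Q'"

inductive strip_co :: "('c, 'k) trm \<Rightarrow> ('c, 'k) trm \<Rightarrow> bool" where
  "strip_co Co Zero"
| "strip_co (Choice F) (Choice F)"
| "strip_co (PVar n) (PVar n)"
| "strip_co (Rec P) (Rec P)"
| "strip_co (Dorm P Q) (Dorm P Q)"
| "strip_co P P' \<Longrightarrow> strip_co (Nu P) (Nu P')"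
| "strip_co P P' \<Longrightarrow> strip_co Q Q' \<Longrightarrow> strip_co (Par P Q) (Par P' Q')"

datatype 'k rlab = RCo (rname: 'k) | RAb (rname: 'k) | RNew (rname: 'k)

inductive reconf :: "('c, 'k) trm \<Rightarrow> 'k rlab \<Rightarrow> ('c, 'k) trm \<Rightarrow> bool" where
  commit: "P \<equiv>\<^sub>s Par Co P'' \<Longrightarrow> strip_co P P' \<Longrightarrow> reconf (Run P k Q) (RCo k) P'"
| new: "reconf (Dorm P Q) (RNew k) (Run P k Q)"
| abort: "reconf (Run P k Q) (RAb k) Q"
| sync: "\<beta> = RCo k \<or> \<beta> = RAb k \<Longrightarrow> reconf P \<beta> P' \<Longrightarrow> reconf Q \<beta> Q'
    \<Longrightarrow> reconf (Par P Q) \<beta> (Par P' Q')"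
| parL: "reconf P \<beta> P' \<Longrightarrow> rname \<beta> \<notin> ftn Q \<Longrightarrow> reconf (Par P Q) \<beta> (Par P' Q)"
| parR: "reconf P \<beta> P' \<Longrightarrow> rname \<beta> \<notin> ftn Q \<Longrightarrow> reconf (Par Q P) \<beta> (Par Q P')"
| nu: "reconf P \<beta> P' \<Longrightarrow> reconf (Nu P) \<beta> (Nu P')"


section \<open>Extended configurations\<close>

datatype ('n, 'e) trn = Intn 'n | Extn 'e

datatype ('c, 'e) hev = HAct (hname: 'e) "'c act" | HAb (hname: 'e) | HCo (hname: 'e)

type_synonym ('c, 'e) hist = "nat \<Rightarrow> ('c, 'e) hev option"
type_synonym ('c, 'n, 'e) proc = "('c, ('n, 'e) trn) trm"
type_synonym ('c, 'n, 'e) conf = "('n, 'e) trn rel \<times> ('c, 'e) hist \<times> ('c, 'n, 'e) proc"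

definition Htrn :: "('c, 'e) hist \<Rightarrow> 'e set" where
  "Htrn H = hname ` ran H"

definition Hasco :: "('c, 'e) hist \<Rightarrow> 'e set" where
  "Hasco H = {k. \<exists>i. H i = Some (HCo k)}"

text \<open>
  An equivalence relation over some subset of the transaction names is an equivalence on its own
  field. In the condition on \<open>Hasco\<close> both names are external, as internal ones never are in \<open>Hasco H\<close>.
\<close>

fun xconf :: "('c, 'n, 'e) conf \<Rightarrow> bool" where
  "xconf (E, H, P) \<longleftrightarrow>
     process P \<and>
     equiv (Field E) E \<and> finite (Field E) \<and>
     finite (dom H) \<and>
     (\<forall>i j x y. H i = Some x \<and> H j = Some y \<and> hname x = hname y \<longrightarrow> i = j) \<and>
     (\<forall>k. (Extn k, Extn k) \<in> E \<longleftrightarrow> k \<in> Htrn H) \<and>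
     (\<forall>k k'. (Extn k, Extn k') \<in> E \<longrightarrow> (k \<in> Hasco H \<longleftrightarrow> k' \<in> Hasco H)) \<and>
     ftn P \<inter> Extn ` Hasco H = {} \<and>
     (\<forall>k k'. (k, k') \<in> E \<and> k \<in> ftn P \<and> k' \<in> ftn P \<longrightarrow> k = k') \<and>
     ftn P \<inter> range Extn \<subseteq> Extn ` Htrn H"

definition eqv_upd :: "'k nsub \<Rightarrow> 'k rel \<Rightarrow> 'k rel" where
  "eqv_upd \<sigma> E = \<Inter>{F. equiv (Field F) F \<and> E \<subseteq> F \<and>
     (\<forall>l \<in> srange \<sigma>. (l, l) \<in> F \<and> (\<forall>k \<in> sdom \<sigma>. (k, l) \<in> F))}"

definition hupd ::
  "('e \<Rightarrow> ('c, 'e) hev) \<Rightarrow> ('n, 'e) trn rel \<Rightarrow> ('n, 'e) trn \<Rightarrow> ('c, 'e) hist \<Rightarrow> ('c, 'e) hist" where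
  "hupd f E k H = (\<lambda>i. case H i of
       Some (HAct k' a) \<Rightarrow> if (Extn k', k) \<in> E then Some (f k') else H i
     | _ \<Rightarrow> H i)"

definition fresh_names :: "('n, 'e) trn \<Rightarrow> ('n, 'e) trn rel \<Rightarrow> ('c, 'e) hist \<Rightarrow> bool" where
  "fresh_names k E H \<longleftrightarrow> k \<notin> Field E \<and> k \<notin> Extn ` Htrn H"

definition Eext :: "('n, 'e) trn rel \<Rightarrow> ('n, 'e) trn \<Rightarrow> 'e set" where
  "Eext E k = {k'. (k, Extn k') \<in> E}"

datatype ('c, 'e) xlab = XTau | XAct 'e "'c act" | XCo "'e set"

text \<open>The rules common to extended and commit-sensitive transitions: all but the commit rule.\<close>

inductive core_step :: "('c, 'n, 'e) conf \<Rightarrow> ('c, 'e) xlab \<Rightarrow> ('c, 'n, 'e) conf \<Rightarrow> bool" where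
  tau: "ptrans P (Plain Tau) Eps Q \<Longrightarrow> core_step (E, H, P) XTau (E, H, Q)"
| tau_named: "ptrans P (Named (Intn k) Tau) \<sigma> Q \<Longrightarrow> fresh_names (Intn k) E H
    \<Longrightarrow> core_step (E, H, P) XTau (eqv_upd \<sigma> E, H, Q)"
| new: "reconf P (RNew (Intn k)) Q \<Longrightarrow> fresh_names (Intn k) E H
    \<Longrightarrow> core_step (E, H, P) XTau (E, H, Q)"
| abort: "reconf P (RAb k) Q \<Longrightarrow> core_step (E, H, P) XTau (E, hupd HAb E k H, Q)"
| act: "ptrans P (Named (Extn k) (Act (map_act Free a))) \<sigma> Q \<Longrightarrow> fresh_names (Extn k) E H
    \<Longrightarrow> i \<notin> dom H
    \<Longrightarrow> core_step (E, H, P) (XAct k a) (eqv_upd \<sigma> E, H(i \<mapsto> HAct k a), Q)"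
| act_ab: "fresh_names (Extn k) E H \<Longrightarrow> Extn k \<notin> ftn P \<Longrightarrow> i \<notin> dom H
    \<Longrightarrow> core_step (E, H, P) (XAct k a) (insert (Extn k, Extn k) E, H(i \<mapsto> HAb k), P)"

inductive ext_rule :: "('c, 'n, 'e) conf \<Rightarrow> ('c, 'e) xlab \<Rightarrow> ('c, 'n, 'e) conf \<Rightarrow> bool" where
  core: "core_step C \<zeta> C' \<Longrightarrow> ext_rule C \<zeta> C'"
| commit: "reconf P (RCo k) Q \<Longrightarrow> ext_rule (E, H, P) XTau (E, hupd HCo E k H, Q)"

inductive cs_rule :: "('c, 'n, 'e) conf \<Rightarrow> ('c, 'e) xlab \<Rightarrow> ('c, 'n, 'e) conf \<Rightarrow> bool" where
  core: "core_step C \<zeta> C' \<Longrightarrow> cs_rule C \<zeta> C'"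
| commit_ext: "reconf P (RCo k) Q \<Longrightarrow> Eext E k \<noteq> {}
    \<Longrightarrow> cs_rule (E, H, P) (XCo (Eext E k)) (E, hupd HCo E k H, Q)"
| commit_int: "reconf P (RCo k) Q \<Longrightarrow> Eext E k = {}
    \<Longrightarrow> cs_rule (E, H, P) XTau (E, hupd HCo E k H, Q)"

text \<open>
  Extended transitions relate extended configurations only. This matters since unfolding
  \<open>rec X. (Dorm P Q | a.X)\<close> puts a dormant transaction under a prefix and so yields no process.
\<close>

definition ext_step :: "('c, 'n, 'e) conf \<Rightarrow> ('c, 'e) xlab \<Rightarrow> ('c, 'n, 'e) conf \<Rightarrow> bool" where
  "ext_step C \<zeta> C' \<longleftrightarrow> xconf C \<and> xconf C' \<and> ext_rule C \<zeta> C'"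

definition cs_step :: "('c, 'n, 'e) conf \<Rightarrow> ('c, 'e) xlab \<Rightarrow> ('c, 'n, 'e) conf \<Rightarrow> bool" where
  "cs_step C \<zeta> C' \<longleftrightarrow> xconf C \<and> xconf C' \<and> cs_rule C \<zeta> C'"

type_synonym ('c, 'n, 'e) lts =
  "('c, 'n, 'e) conf \<Rightarrow> ('c, 'e) xlab \<Rightarrow> ('c, 'n, 'e) conf \<Rightarrow> bool"

definition weak :: "('c, 'n, 'e) lts \<Rightarrow> ('c, 'n, 'e) lts" where
  "weak step C \<zeta> C' \<longleftrightarrow>
     (let taus = (\<lambda>D D'. step D XTau D')\<^sup>*\<^sup>* in
      if \<zeta> = XTau then taus C C'
      else \<exists>D D'. taus C D \<and> step D \<zeta> D' \<and> taus D' C')"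


section \<open>Logics\<close>

datatype 'e val = Nm 'e | Vr nat

text \<open>
  The three logics are fragments of one language. \<open>FConj G\<close> is the conjunction of the \<open>\<phi>\<^sub>i\<close> with
  \<open>G i = Some \<phi>\<^sub>i\<close>; its index set is \<open>dom G\<close>. A datatype cannot range over index sets of every
  cardinality, so these are the subsets of a type \<open>'i\<close>, a parameter of the logics. Results about
  arbitrary index sets are to be stated for every sufficiently large \<open>'i\<close>: any set-indexed family
  of formulae is a formula for some such \<open>'i\<close>.
\<close>

datatype ('c, 'e, 'i) form =
    FTau "('c, 'e, 'i) form"
  | FAct nat "'c act" "('c, 'e, 'i) form"
  | FNeg "('c, 'e, 'i) form"
  | FConj "'i \<Rightarrow> ('c, 'e, 'i) form option"
  | FHasco "'e val"
  | FEq "'e val" "'e val"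
  | FCo "'e val set" "('c, 'e, 'i) form"

inductive_set form_Hasco :: "('c, 'e, 'i) form set" where
  "\<phi> \<in> form_Hasco \<Longrightarrow> FTau \<phi> \<in> form_Hasco"
| "\<phi> \<in> form_Hasco \<Longrightarrow> FAct x a \<phi> \<in> form_Hasco"
| "\<phi> \<in> form_Hasco \<Longrightarrow> FNeg \<phi> \<in> form_Hasco"
| "(\<And>i \<phi>. G i = Some \<phi> \<Longrightarrow> \<phi> \<in> form_Hasco) \<Longrightarrow> FConj G \<in> form_Hasco"
| "FHasco v \<in> form_Hasco"

inductive_set form_Eq :: "('c, 'e, 'i) form set" where
  "\<phi> \<in> form_Eq \<Longrightarrow> FTau \<phi> \<in> form_Eq"
| "\<phi> \<in> form_Eq \<Longrightarrow> FAct x a \<phi> \<in> form_Eq"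
| "\<phi> \<in> form_Eq \<Longrightarrow> FNeg \<phi> \<in> form_Eq"
| "(\<And>i \<phi>. G i = Some \<phi> \<Longrightarrow> \<phi> \<in> form_Eq) \<Longrightarrow> FConj G \<in> form_Eq"
| "FEq v1 v2 \<in> form_Eq"

inductive_set form_Canco :: "('c, 'e, 'i) form set" where
  "\<phi> \<in> form_Canco \<Longrightarrow> FTau \<phi> \<in> form_Canco"
| "\<phi> \<in> form_Canco \<Longrightarrow> FAct x a \<phi> \<in> form_Canco"
| "\<phi> \<in> form_Canco \<Longrightarrow> FNeg \<phi> \<in> form_Canco"
| "(\<And>i \<phi>. G i = Some \<phi> \<Longrightarrow> \<phi> \<in> form_Canco) \<Longrightarrow> FConj G \<in> form_Canco"
| "K \<noteq> {} \<Longrightarrow> \<phi> \<in> form_Canco \<Longrightarrow> FCo K \<phi> \<in> form_Canco"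

primrec fv :: "('c, 'e, 'i) form \<Rightarrow> nat set" where
  "fv (FTau \<phi>) = fv \<phi>"
| "fv (FAct x a \<phi>) = fv \<phi> - {x}"
| "fv (FNeg \<phi>) = fv \<phi>"
| "fv (FConj G) = (\<Union>i. \<Union>(set_option (map_option fv (G i))))"
| "fv (FHasco v) = {x. v = Vr x}"
| "fv (FEq v1 v2) = {x. v1 = Vr x \<or> v2 = Vr x}"
| "fv (FCo K \<phi>) = {x. Vr x \<in> K} \<union> fv \<phi>"

definition vsub :: "nat \<Rightarrow> 'e \<Rightarrow> 'e val \<Rightarrow> 'e val" where
  "vsub x l v = (if v = Vr x then Nm l else v)"

primrec fsub :: "nat \<Rightarrow> 'e \<Rightarrow> ('c, 'e, 'i) form \<Rightarrow> ('c, 'e, 'i) form" where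
  "fsub x l (FTau \<phi>) = FTau (fsub x l \<phi>)"
| "fsub x l (FAct y a \<phi>) = FAct y a (if x = y then \<phi> else fsub x l \<phi>)"
| "fsub x l (FNeg \<phi>) = FNeg (fsub x l \<phi>)"
| "fsub x l (FConj G) = FConj (\<lambda>i. map_option (fsub x l) (G i))"
| "fsub x l (FHasco v) = FHasco (vsub x l v)"
| "fsub x l (FEq v1 v2) = FEq (vsub x l v1) (vsub x l v2)"
| "fsub x l (FCo K \<phi>) = FCo (vsub x l ` K) (fsub x l \<phi>)"

text \<open>
  Satisfaction recurses on \<open>fsub x l \<phi>\<close>, which is no subformula. It terminates since substitution
  preserves the formula up to the values in it, which \<open>skel\<close> erases.
\<close>

primrec skel :: "('c, 'e, 'i) form \<Rightarrow> ('c, 'e, 'i) form" where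
  "skel (FTau \<phi>) = FTau (skel \<phi>)"
| "skel (FAct x a \<phi>) = FAct x a (skel \<phi>)"
| "skel (FNeg \<phi>) = FNeg (skel \<phi>)"
| "skel (FConj G) = FConj (\<lambda>i. map_option skel (G i))"
| "skel (FHasco v) = FHasco (Vr 0)"
| "skel (FEq v1 v2) = FEq (Vr 0) (Vr 0)"
| "skel (FCo K \<phi>) = FCo {} (skel \<phi>)"

inductive_set isub :: "(('c, 'e, 'i) form \<times> ('c, 'e, 'i) form) set" where
  "(\<phi>, FTau \<phi>) \<in> isub"
| "(\<phi>, FAct x a \<phi>) \<in> isub"
| "(\<phi>, FNeg \<phi>) \<in> isub"
| "G i = Some \<phi> \<Longrightarrow> (\<phi>, FConj G) \<in> isub"
| "(\<phi>, FCo K \<phi>) \<in> isub"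

lemma skel_fsub: "skel (fsub x l \<phi>) = skel \<phi>"
proof (induction \<phi>)
  case (FConj G)
  have "skel (fsub x l \<psi>) = skel \<psi>" if "G i = Some \<psi>" for i \<psi>
    using FConj[of "G i" \<psi>] that by (metis option.set_intros rangeI)
  then have "map_option skel (map_option (fsub x l) (G i)) = map_option skel (G i)" for i
    by (cases "G i") auto
  then show ?case by simp
qed auto

lemma wf_isub: "wf (isub :: (('c, 'e, 'i) form \<times> ('c, 'e, 'i) form) set)"
proof (rule wfUNIVI)
  fix P :: "('c, 'e, 'i) form \<Rightarrow> bool" and \<phi>
  assume step: "\<forall>\<phi>. (\<forall>\<psi>. (\<psi>, \<phi>) \<in> isub \<longrightarrow> P \<psi>) \<longrightarrow> P \<phi>"
  show "P \<phi>"
  proof (induction \<phi>)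
    case (FConj G)
    have "P \<psi>" if "G i = Some \<psi>" for i \<psi>
      using FConj[of "G i" \<psi>] that by (metis option.set_intros rangeI)
    then show ?case using step by (blast elim: isub.cases)
  qed (use step in \<open>blast elim: isub.cases\<close>)+
qed

function sat :: "('c, 'n, 'e) lts \<Rightarrow> ('c, 'n, 'e) conf \<Rightarrow> ('c, 'e, 'i) form \<Rightarrow> bool" where
  "sat step C (FTau \<phi>) \<longleftrightarrow> (\<exists>C'. weak step C XTau C' \<and> sat step C' \<phi>)"
| "sat step C (FAct x a \<phi>) \<longleftrightarrow>
     (\<exists>N. finite (- N) \<and>
        (\<forall>l\<in>N. \<exists>C'. weak step C (XAct l a) C' \<and> sat step C' (fsub x l \<phi>)))"
| "sat step C (FNeg \<phi>) \<longleftrightarrow> \<not> sat step C \<phi>"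
| "sat step C (FConj G) \<longleftrightarrow> (\<forall>i \<phi>. G i = Some \<phi> \<longrightarrow> sat step C \<phi>)"
| "sat step C (FHasco v) \<longleftrightarrow> (\<exists>k. v = Nm k \<and> k \<in> Hasco (fst (snd C)))"
| "sat step C (FEq v1 v2) \<longleftrightarrow>
     (\<exists>k k'. v1 = Nm k \<and> v2 = Nm k' \<and> k \<in> Hasco (fst (snd C)) \<and> k' \<in> Hasco (fst (snd C)) \<and>
        (Extn k, Extn k') \<in> fst C)"
| "sat step C (FCo K \<phi>) \<longleftrightarrow>
     (\<exists>L C'. K = Nm ` L \<and> weak step C (XCo L) C' \<and> sat step C' \<phi>)"
  by pat_completeness auto
termination
  by (relation "inv_image isub (\<lambda>(step, C, \<phi>). skel \<phi>)")
    (auto simp: wf_isub skel_fsub intro: isub.intros)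

type_synonym ('c, 'n, 'e, 'i) logic = "('c, 'n, 'e) proc \<Rightarrow> ('c, 'e, 'i) form set"

definition L_Hasco :: "('c, 'n, 'e, 'i) logic" where
  "L_Hasco P = {\<phi> \<in> form_Hasco. fv \<phi> = {} \<and> sat ext_step ({}, Map.empty, P) \<phi>}"

definition L_Eq :: "('c, 'n, 'e, 'i) logic" where
  "L_Eq P = {\<phi> \<in> form_Eq. fv \<phi> = {} \<and> sat ext_step ({}, Map.empty, P) \<phi>}"

definition L_Canco :: "('c, 'n, 'e, 'i) logic" where
  "L_Canco P = {\<phi> \<in> form_Canco. fv \<phi> = {} \<and> sat cs_step ({}, Map.empty, P) \<phi>}"

text \<open>
  A process is viewed as a configuration with empty history, whence it has no external names.
\<close>

definition logic_le :: "('c, 'n, 'e, 'i) logic \<Rightarrow> ('c, 'n, 'e, 'i) logic \<Rightarrow> bool"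
    (infix "\<preceq>" 50) where
  "L1 \<preceq> L2 \<longleftrightarrow>
     (\<forall>P Q. process P \<and> ftn P \<subseteq> range Intn \<and> process Q \<and> ftn Q \<subseteq> range Intn \<longrightarrow>
        L2 P = L2 Q \<longrightarrow> L1 P = L1 Q)"

end

theory Submission
  imports Defs "HOL-Combinatorics.Transposition"
begin

text \<open>
  Each of the logics characterises, by the argument of Hennessy and Milner, a weak bisimilarity: the
  formula that separates a transition from its candidate matches is a conjunction over configurations.
  For the modality \<open>FAct\<close> this formula is turned into one for almost all names since the transitions are
  equivariant under transpositions of external names.

  It remains to compare the bisimilarities. Once committed, an equivalence class of names never
  changes, so the relation \<open>co_eq\<close> on committed names is determined by the sets \<open>K\<close> in the labels
  \<open>co(K)\<close>, whence \<open>L_Eq \<preceq> L_Canco\<close>. Conversely, \<open>co(K)\<close> is a silent transition that adds \<open>K\<close> to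
  \<open>Hasco\<close>. A match adds \<open>K\<close> as well and must do so at once: adding a proper part of \<open>K\<close> first could not
  be matched in turn, because \<open>Hasco\<close> is saturated under an equivalence that relates all of \<open>K\<close>.
\<close>

section \<open>Renaming of transaction names in terms\<close>

text \<open>Extended and commit-sensitive transitions have the same steps and differ only in the
  label of an external commit. Hiding that label is harmless. Recovering it is the obstacle: a
  silent match may contain any number of external commits, and \<open>FHasco\<close> shows which
  names are committed, not how they were grouped. Growth is what counts them: each external commit
  strictly enlarges \<open>Hasco\<close>, so an unchanged \<open>Hasco\<close> certifies that none
  took place. Neither \<open>form_Hasco\<close> nor \<open>form_Canco\<close> has an atom for
  \<open>co_eq\<close>. Its equality is therefore a separate component of the relations that start
  from these fragments: \<open>co_eq\<close> is empty at the start, and matching steps with label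
  \<open>co(K)\<close> add the same square of \<open>K\<close> to both sides. The handling of names
  rests on finiteness. A history has finitely many names and records every external name of its
  configuration, so almost all names are interchangeable for it. Thus one transition yields almost
  all instances of \<open>FAct\<close>, and one fresh instance can be brought back to the original
  name.\<close>

lemma trm_induct [case_names Choice Par Nu PVar Rec Run Co Dorm]:
  assumes "\<And>F. (\<And>i \<mu> Q. F i = Some (\<mu>, Q) \<Longrightarrow> \<Phi> Q) \<Longrightarrow> \<Phi> (Choice F)"
    "\<And>P Q. \<Phi> P \<Longrightarrow> \<Phi> Q \<Longrightarrow> \<Phi> (Par P Q)" "\<And>P. \<Phi> P \<Longrightarrow> \<Phi> (Nu P)" "\<And>n. \<Phi> (PVar n)"
    "\<And>P. \<Phi> P \<Longrightarrow> \<Phi> (Rec P)" "\<And>P k Q. \<Phi> P \<Longrightarrow> \<Phi> Q \<Longrightarrow> \<Phi> (Run P k Q)" "\<Phi> Co"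
    "\<And>P Q. \<Phi> P \<Longrightarrow> \<Phi> Q \<Longrightarrow> \<Phi> (Dorm P Q)"
  shows "\<Phi> P"
proof (induction P)
  case (Choice F)
  have "\<Phi> Q" if "F i = Some (\<mu>, Q)" for i \<mu> Q
    using Choice[of "F i" "(\<mu>, Q)" Q] that by (metis option.set_intros rangeI snds.intros snd_conv)
  then show ?case by (rule assms(1))
qed (simp_all add: assms(2-8))

lemma map_option_cong_Some: "(\<And>y. x = Some y \<Longrightarrow> f y = g y) \<Longrightarrow> map_option f x = map_option g x"
  by (cases x) auto

lemma ren_map_trm: "ren (map_trm f P) r = map_trm f (ren P r)"
proof (induction P arbitrary: r rule: trm_induct)
  case (Choice F)
  then show ?case by (auto simp: fun_eq_iff option.map_comp intro!: map_option_cong_Some)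
qed auto

lemma subst_map_trm: "subst (map_trm f P) n (map_trm f R) = map_trm f (subst P n R)"
proof (induction P arbitrary: n R rule: trm_induct)
  case (Choice F)
  then show ?case by (auto simp: fun_eq_iff option.map_comp intro!: map_option_cong_Some)
qed (auto simp: lift_def ren_map_trm)

primrec map_nsub :: "('k \<Rightarrow> 'k) \<Rightarrow> 'k nsub \<Rightarrow> 'k nsub" where
  "map_nsub f Eps = Eps"
| "map_nsub f (Maps ks l) = Maps (map f ks) (f l)"

primrec map_lab_name :: "('k \<Rightarrow> 'k) \<Rightarrow> ('x, 'k) lab \<Rightarrow> ('x, 'k) lab" where
  "map_lab_name f (Plain \<mu>) = Plain \<mu>"
| "map_lab_name f (Named k \<mu>) = Named (f k) \<mu>"

lemma sapp_map_nsub: "inj f \<Longrightarrow> sapp (map_nsub f \<sigma>) (f k) = f (sapp \<sigma> k)"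
  by (cases \<sigma>) (auto dest: injD)

lemma tsub_map_trm:
  "inj f \<Longrightarrow> map_trm (sapp (map_nsub f \<sigma>)) (map_trm f P) = map_trm f (tsub P \<sigma>)"
  by (simp add: trm.map_comp sapp_map_nsub comp_def)

lemma srange_map_nsub: "srange (map_nsub f \<sigma>) = f ` srange \<sigma>"
  by (cases \<sigma>) auto

lemma shl_map_lab_name: "shl (map_lab_name f \<alpha>) = map_lab_name f (shl \<alpha>)"
  by (cases \<alpha>) auto

text \<open>Injectivity preserves the side conditions \<open>k \<noteq> l\<close> and
  \<open>srange \<sigma> \<inter> ftn Q = {}\<close>, and it makes the renamed substitution act on
  renamed terms as the old one did.\<close>

lemma ptrans_map_trm:
  assumes "inj f" "ptrans P \<alpha> \<sigma> Q"
  shows "ptrans (map_trm f P) (map_lab_name f \<alpha>) (map_nsub f \<sigma>) (map_trm f Q)"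
  using assms(2)
proof induction
  case (sum F j \<mu> P)
  then show ?case by (auto intro!: ptrans.sum)
next
  case (com P a P' Q Q')
  then show ?case by (auto intro!: ptrans.com)
next
  case (unfold P)
  then show ?case using ptrans.unfold[of "map_trm f P"] subst_map_trm[of f P 0 "Rec P"] by simp
next
  case (sum_embed F j a P k)
  then show ?case using ptrans.sum_embed[of "map_option (map_prod id (map_trm f)) \<circ> F" j a "map_trm f P" "f k"]
    by (simp add: comp_def)
next
  case (run P \<mu> P' k l Q)
  then show ?case using assms(1) by (auto intro!: ptrans.run dest: injD)
next
  case (com_named P k a \<sigma>1 P' Q \<sigma>2 Q' ls1 ls2)
  then show ?case
    using ptrans.com_named[of "map_trm f P" "f k" a "map_nsub f \<sigma>1" "map_trm f P'" "map_trm f Q"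
        "map_nsub f \<sigma>2" "map_trm f Q'" "map f ls1" "map f ls2"]
    unfolding tsub_map_trm[OF assms(1)] by simp
next
  case (parL P \<alpha> \<sigma> P' Q)
  have "srange (map_nsub f \<sigma>) \<inter> ftn (map_trm f Q) = {}"
    using parL.hyps(2) assms(1) by (auto simp: srange_map_nsub trm.set_map dest: injD)
  from ptrans.parL[OF parL.IH this] show ?case
    unfolding tsub_map_trm[OF assms(1)] by simp
next
  case (parR P \<alpha> \<sigma> P' Q)
  have "srange (map_nsub f \<sigma>) \<inter> ftn (map_trm f Q) = {}"
    using parR.hyps(2) assms(1) by (auto simp: srange_map_nsub trm.set_map dest: injD)
  from ptrans.parR[OF parR.IH this] show ?case
    unfolding tsub_map_trm[OF assms(1)] by simp
next
  case (nu P \<alpha> \<sigma> P')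
  then show ?case by (auto simp: shl_map_lab_name intro!: ptrans.nu)
qed

lemma sc_map_trm: "P \<equiv>\<^sub>s Q \<Longrightarrow> map_trm f P \<equiv>\<^sub>s map_trm f Q"
proof (induction rule: sc.induct)
  case (par_zero P)
  then show ?case using sc.par_zero[of "map_trm f P"] by (simp add: Zero_def comp_def)
next
  case nu_zero
  then show ?case using sc.nu_zero by (simp add: Zero_def comp_def)
next
  case (nu_swap P)
  then show ?case using sc.nu_swap[of "map_trm f P"] by (simp add: ren_map_trm)
next
  case (nu_par P Q)
  then show ?case using sc.nu_par[of "map_trm f P" "map_trm f Q"] by (simp add: ren_map_trm lift_def)
next
  case (reindex \<pi> F G)
  have D: "dom (map_option g \<circ> F') = dom F'" for g :: "'x \<Rightarrow> 'y" and F' :: "nat \<Rightarrow> 'x option"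
    by (auto simp: dom_def)
  show ?case unfolding trm.map
    by (rule sc.reindex[where \<pi>=\<pi>]) (use reindex D in \<open>force\<close>)+
next
  case (cong_choice F G)
  have D: "dom (map_option g \<circ> F') = dom F'" for g :: "'x \<Rightarrow> 'y" and F' :: "nat \<Rightarrow> 'x option"
    by (auto simp: dom_def)
  show ?case unfolding trm.map
    by (rule sc.cong_choice) (use cong_choice D in \<open>fastforce\<close>)+
qed (auto intro: sc.intros)

lemma strip_co_map_trm: "strip_co P Q \<Longrightarrow> strip_co (map_trm f P) (map_trm f Q)"
  by (induction rule: strip_co.induct)
    (auto intro: strip_co.intros simp: Zero_def comp_def strip_co.intros(1)[unfolded Zero_def])

lemma rname_map_rlab: "rname (map_rlab f \<beta>) = f (rname \<beta>)"
  by (cases \<beta>) auto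

lemma reconf_map_trm:
  assumes "inj f" "reconf P \<beta> Q"
  shows "reconf (map_trm f P) (map_rlab f \<beta>) (map_trm f Q)"
  using assms(2)
proof induction
  case (commit P P'' P' k Q)
  then show ?case using sc_map_trm[OF commit(1), of f] strip_co_map_trm[OF commit(2), of f]
    by (auto intro: reconf.commit)
next
  case (parL P \<beta> P' Q)
  then show ?case using assms(1) by (auto intro!: reconf.parL simp: rname_map_rlab trm.set_map dest: injD)
next
  case (parR P \<beta> P' Q)
  then show ?case using assms(1) by (auto intro!: reconf.parR simp: rname_map_rlab trm.set_map dest: injD)
next
  case (sync \<beta> k P P' Q Q')
  then show ?case by (auto intro!: reconf.sync)
qed (auto intro: reconf.intros)

text \<open>Well-formedness quantifies over the subterms of the renamed term; this pulls each of
  them back to a subterm of the original, whose conditions are known.\<close>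

lemma subterm_map_trm_iff:
  "subterm R (map_trm f P) \<longleftrightarrow> (\<exists>R'. R = map_trm f R' \<and> subterm R' P)"
proof
  have "T = map_trm f P \<Longrightarrow> \<exists>R'. R = map_trm f R' \<and> subterm R' P" if "subterm R T" for T
    using that
  proof (induction arbitrary: P rule: subterm.induct)
    case (1 T)
    then show ?case using subterm.intros(1) by blast
  next
    case (2 F i \<mu> Q R)
    then obtain G where G: "P = Choice G" by (cases P) auto
    with 2 obtain Q' where "G i = Some (\<mu>, Q')" "Q = map_trm f Q'" by auto
    with 2 G show ?case using subterm.intros(2) by blast
  next
    case (3 R P' Q')
    then show ?case by (cases P) (simp_all, blast intro: subterm.intros)
  next
    case (4 R P' Q')
    then show ?case by (cases P) (simp_all, blast intro: subterm.intros)
  next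
    case (5 R P')
    then show ?case by (cases P) (simp_all, blast intro: subterm.intros)
  next
    case (6 R P')
    then show ?case by (cases P) (simp_all, blast intro: subterm.intros)
  next
    case (7 R P' k Q')
    then show ?case by (cases P) (simp_all, blast intro: subterm.intros)
  next
    case (8 R P' k Q')
    then show ?case by (cases P) (simp_all, blast intro: subterm.intros)
  next
    case (9 R P' Q')
    then show ?case by (cases P) (simp_all, blast intro: subterm.intros)
  next
    case (10 R P' Q')
    then show ?case by (cases P) (simp_all, blast intro: subterm.intros)
  qed
  then show "\<exists>R'. R = map_trm f R' \<and> subterm R' P" if "subterm R (map_trm f P)"
    using that by blast
next
  have "subterm (map_trm f R') (map_trm f P)" if "subterm R' P" for R'
    using that
  proof (induction rule: subterm.induct)
    case (2 F i \<mu> P R)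
    then show ?case by (auto intro!: subterm.intros(2)[of _ i \<mu> "map_trm f P"])
  qed (auto intro: subterm.intros)
  then show "subterm R (map_trm f P)" if "\<exists>R'. R = map_trm f R' \<and> subterm R' P"
    using that by blast
qed

lemma pclosed_map_trm: "pclosed n P \<Longrightarrow> pclosed n (map_trm f P)"
  by (induction rule: pclosed.induct) (auto intro!: pclosed.intros)

lemma cclosed_map_trm: "cclosed n P \<Longrightarrow> cclosed n (map_trm f P)"
  by (induction rule: cclosed.induct) (auto intro!: cclosed.intros)

lemma no_dorm_map_trm: "no_dorm P \<Longrightarrow> no_dorm (map_trm f P)"
proof -
  have "\<exists>P1' P2'. R' = Dorm P1' P2'" if "Dorm P1 P2 = map_trm f R'" for P1 P2 R'
    using that by (cases R') auto
  then show "no_dorm P \<Longrightarrow> no_dorm (map_trm f P)"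
    unfolding no_dorm_def subterm_map_trm_iff by blast
qed

lemma process_map_trm:
  assumes "process P"
  shows "process (map_trm f P)"
proof -
  have "ftn P1 = {} \<and> ftn P1' = {} \<and> no_dorm P1 \<and> pclosed 0 P1"
    if "subterm (Run P1 k P1') (map_trm f P)" for P1 k P1'
  proof -
    from that obtain R where R: "Run P1 k P1' = map_trm f R" "subterm R P"
      by (auto simp: subterm_map_trm_iff)
    then obtain A l B where AB: "R = Run A l B" by (cases R) auto
    with R assms have "ftn A = {} \<and> ftn B = {} \<and> no_dorm A \<and> pclosed 0 A"
      unfolding process_def by blast
    with R AB show ?thesis by (auto simp: trm.set_map no_dorm_map_trm pclosed_map_trm)
  qed
  moreover have "ftn P1 = {} \<and> ftn P1' = {} \<and> no_dorm P1 \<and> pclosed 0 P1"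
    if "subterm (Dorm P1 P1') (map_trm f P)" for P1 P1'
  proof -
    from that obtain R where R: "Dorm P1 P1' = map_trm f R" "subterm R P"
      by (auto simp: subterm_map_trm_iff)
    then obtain A B where AB: "R = Dorm A B" by (cases R) auto
    with R assms have "ftn A = {} \<and> ftn B = {} \<and> no_dorm A \<and> pclosed 0 A"
      unfolding process_def by blast
    with R AB show ?thesis by (auto simp: trm.set_map no_dorm_map_trm pclosed_map_trm)
  qed
  moreover have "ftn Q = {} \<and> no_dorm Q"
    if "subterm (Choice F) (map_trm f P)" "F i = Some (\<mu>, Q)" for F i \<mu> Q
  proof -
    from that obtain R where R: "Choice F = map_trm f R" "subterm R P"
      by (auto simp: subterm_map_trm_iff)
    then obtain G where G: "R = Choice G" by (cases R) auto
    with R(1) that(2) obtain Q' where Q': "G i = Some (\<mu>, Q')" "Q = map_trm f Q'" by auto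
    with R G assms have "ftn Q' = {} \<and> no_dorm Q'"
      unfolding process_def by blast
    with Q' show ?thesis by (auto simp: trm.set_map no_dorm_map_trm)
  qed
  moreover have "ftn Q = {}" if "subterm (Rec Q) (map_trm f P)" for Q
  proof -
    from that obtain R where R: "Rec Q = map_trm f R" "subterm R P"
      by (auto simp: subterm_map_trm_iff)
    then obtain A where A: "R = Rec A" by (cases R) auto
    with R assms have "ftn A = {}"
      unfolding process_def by blast
    with R A show ?thesis by (auto simp: trm.set_map)
  qed
  moreover have "cclosed 0 (map_trm f P)" "pclosed 0 (map_trm f P)" "finite (ftn (map_trm f P))"
    using assms unfolding process_def
    by (auto simp: trm.set_map pclosed_map_trm cclosed_map_trm)
  ultimately show ?thesis
    unfolding process_def by (intro conjI allI impI) blast+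
qed

section \<open>Transaction names and the frozen classes\<close>

lemma mem_ftn_Choice: "k \<in> ftn (Choice F) \<longleftrightarrow> (\<exists>i \<mu> Q. F i = Some (\<mu>, Q) \<and> k \<in> ftn Q)"
proof -
  have "k \<in> ftn (Choice F) \<longleftrightarrow> (\<exists>i. \<exists>y \<in> set_option (F i). k \<in> ftn (snd y))"
    by (simp add: prod_set_defs)
  then show ?thesis by (metis option.set_cases option.set_intros snd_conv surj_pair)
qed

lemma ftn_branch: "F i = Some (\<mu>, Q) \<Longrightarrow> ftn Q \<subseteq> ftn (Choice F)"
  unfolding subset_iff mem_ftn_Choice by blast

lemma ftn_ren: "ftn (ren P r) = ftn P"
proof (induction P arbitrary: r rule: trm_induct)
  case (Choice F)
  have "k \<in> ftn (ren (Choice F) r) \<longleftrightarrow> k \<in> ftn (Choice F)" for k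
    unfolding ren.simps mem_ftn_Choice using Choice by (auto; fastforce)
  then show ?case by blast
qed auto

lemma ftn_subst: "ftn (subst P n R) \<subseteq> ftn P \<union> ftn R"
proof (induction P arbitrary: n R rule: trm_induct)
  case (Choice F)
  have "k \<in> ftn (Choice F) \<or> k \<in> ftn R" if "k \<in> ftn (subst (Choice F) n R)" for k
    using that Choice unfolding subst.simps mem_ftn_Choice by fastforce
  then show ?case by blast
next
  case (Nu P)
  then show ?case using Nu[of n "lift R"] by (simp add: lift_def ftn_ren)
next
  case (Par P Q)
  then show ?case by auto blast+
next
  case (Run P k Q)
  then show ?case by auto blast+
next
  case (Dorm P Q)
  then show ?case by auto blast+
qed auto

lemma ftn_tsub: "ftn (tsub P \<sigma>) \<subseteq> ftn P \<union> srange \<sigma>"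
  by (cases \<sigma>) (auto simp: trm.set_map split: if_splits)

lemma ptrans_ftn:
  assumes "ptrans P \<alpha> \<sigma> Q"
  shows "sdom \<sigma> \<subseteq> ftn P \<and> ftn Q \<subseteq> ftn P \<union> srange \<sigma>"
  using assms
proof induction
  case (sum F j \<mu> P)
  then show ?case using ftn_branch by fastforce
next
  case (unfold P)
  then show ?case using ftn_subst[of P 0 "Rec P"] by auto
next
  case (sum_embed F j a P k)
  then have "ftn P \<subseteq> ftn (Choice F)" by (rule ftn_branch)
  moreover have "ftn (Run (Par P Co) k (Choice F)) = insert k (ftn P \<union> ftn (Choice F))"
    by auto
  ultimately show ?case by (auto simp del: trm.set)
next
  case (com_named P k a \<sigma>1 P' Q \<sigma>2 Q' ls1 ls2)
  then show ?case using ftn_tsub[of \<sigma>2 P'] ftn_tsub[of \<sigma>1 Q'] by auto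
next
  case (parL P \<alpha> \<sigma> P' Q)
  then show ?case using ftn_tsub[of \<sigma> Q] by auto
next
  case (parR P \<alpha> \<sigma> P' Q)
  then show ?case using ftn_tsub[of \<sigma> Q] by auto
qed auto

text \<open>The list may be empty, as when a sum is embedded, but the range is always present, so
  that the explicit form of \<open>eqv_upd\<close> applies.\<close>

lemma ptrans_Named:
  assumes "ptrans P \<alpha> \<sigma> Q" "\<alpha> = Named k \<mu>"
  shows "\<exists>ls. \<sigma> = Maps ls k"
  using assms by (induction arbitrary: \<mu> rule: ptrans.induct) auto

text \<open>A commit or abort of \<open>k\<close> reaches every component that contains
  \<open>k\<close>: either both sides synchronise or the idle side lacks \<open>k\<close>. What is
  released is the body or the fallback of a running transaction; these have no names by assumption,
  so \<open>k\<close> cannot reappear.\<close>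

lemma reconf_ftn:
  assumes "reconf P \<beta> Q"
    "\<And>P1 k P1'. subterm (Run P1 k P1') P \<Longrightarrow> ftn P1 = {} \<and> ftn P1' = {}"
  shows "ftn Q \<subseteq> insert (rname \<beta>) (ftn P) \<and>
    ((\<forall>k. \<beta> \<noteq> RNew k) \<longrightarrow> rname \<beta> \<in> ftn P \<and> rname \<beta> \<notin> ftn Q)"
  using assms
proof (induction rule: reconf.induct)
  case (commit P P'' P' k Q)
  have "ftn P' \<subseteq> ftn P"
    using commit(2) by induction (auto simp: Zero_def)
  moreover have "ftn P = {}" using commit(3) subterm.intros(1) by blast
  ultimately show ?case by auto
next
  case (abort P k Q)
  have "ftn Q = {}" using abort subterm.intros(1) by blast
  then show ?case by auto
next
  case (sync \<beta> k P P' Q Q')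
  have "ftn P' \<subseteq> insert (rname \<beta>) (ftn P) \<and>
    ((\<forall>k. \<beta> \<noteq> RNew k) \<longrightarrow> rname \<beta> \<in> ftn P \<and> rname \<beta> \<notin> ftn P')"
    by (rule sync) (use sync.prems subterm.intros(3) in blast)
  moreover have "ftn Q' \<subseteq> insert (rname \<beta>) (ftn Q) \<and>
    ((\<forall>k. \<beta> \<noteq> RNew k) \<longrightarrow> rname \<beta> \<in> ftn Q \<and> rname \<beta> \<notin> ftn Q')"
    by (rule sync) (use sync.prems subterm.intros(4) in blast)
  ultimately show ?case by auto
next
  case (parL P \<beta> P' Q)
  have "ftn P' \<subseteq> insert (rname \<beta>) (ftn P) \<and>
    ((\<forall>k. \<beta> \<noteq> RNew k) \<longrightarrow> rname \<beta> \<in> ftn P \<and> rname \<beta> \<notin> ftn P')"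
    by (rule parL) (use parL.prems subterm.intros(3) in blast)
  then show ?case using parL(2) by auto
next
  case (parR P \<beta> P' Q)
  have "ftn P' \<subseteq> insert (rname \<beta>) (ftn P) \<and>
    ((\<forall>k. \<beta> \<noteq> RNew k) \<longrightarrow> rname \<beta> \<in> ftn P \<and> rname \<beta> \<notin> ftn P')"
    by (rule parR) (use parR.prems subterm.intros(4) in blast)
  then show ?case using parR(2) by auto
next
  case (nu P \<beta> P')
  have "ftn P' \<subseteq> insert (rname \<beta>) (ftn P) \<and>
    ((\<forall>k. \<beta> \<noteq> RNew k) \<longrightarrow> rname \<beta> \<in> ftn P \<and> rname \<beta> \<notin> ftn P')"
    by (rule nu) (use nu.prems subterm.intros(5) in blast)
  then show ?case by auto
qed auto

text \<open>The closure adds a single block: the names identified by the substitution, with the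
  classes they already have. Transitivity asks for no more, since no class of \<open>E\<close>
  crosses the boundary of the block.\<close>

lemma eqv_upd_Maps:
  assumes "equiv (Field E) E"
  shows "eqv_upd (Maps ls k) E =
    E \<union> (insert k (set ls) \<union> E `` set ls \<union> E `` {k}) \<times> (insert k (set ls) \<union> E `` set ls \<union> E `` {k})"
    (is "_ = E \<union> ?B \<times> ?B")
proof
  have s: "(x, y) \<in> E \<Longrightarrow> (y, x) \<in> E" and t: "(x, y) \<in> E \<Longrightarrow> (y, z) \<in> E \<Longrightarrow> (x, z) \<in> E"
    and r: "x \<in> Field E \<Longrightarrow> (x, x) \<in> E" for x y z
    using assms by (auto simp: equiv_def refl_on_def dest: symD transD)
  have cl: "x \<in> ?B \<Longrightarrow> (x, y) \<in> E \<Longrightarrow> y \<in> ?B" for x y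
    using t by blast
  let ?F = "E \<union> ?B \<times> ?B"
  have Fi: "Field ?F = Field E \<union> ?B" by (auto simp: Field_def)
  have "refl_on (Field ?F) ?F" unfolding Fi refl_on_def using r by blast
  moreover have "sym ?F" by (rule symI) (use s in blast)
  moreover have "trans ?F"
  proof (rule transI)
    fix x y z assume "(x, y) \<in> ?F" "(y, z) \<in> ?F"
    then show "(x, z) \<in> ?F" using cl s t by blast
  qed
  ultimately have "equiv (Field ?F) ?F"
    unfolding equiv_def by (auto simp: Field_def)
  then show "eqv_upd (Maps ls k) E \<subseteq> ?F"
    unfolding eqv_upd_def by (intro Inter_lower) auto
  show "?F \<subseteq> eqv_upd (Maps ls k) E"
    unfolding eqv_upd_def
  proof (rule Inter_greatest)
    fix F assume "F \<in> {F. equiv (Field F) F \<and> E \<subseteq> F \<and>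
      (\<forall>l\<in>srange (Maps ls k). (l, l) \<in> F \<and> (\<forall>k\<in>sdom (Maps ls k). (k, l) \<in> F))}"
    then have F: "equiv (Field F) F" "E \<subseteq> F" "(k, k) \<in> F" "\<And>l. l \<in> set ls \<Longrightarrow> (l, k) \<in> F"
      by auto
    have s: "(x, y) \<in> F \<Longrightarrow> (y, x) \<in> F" and t: "(x, y) \<in> F \<Longrightarrow> (y, z) \<in> F \<Longrightarrow> (x, z) \<in> F" for x y z
      using F(1) by (auto simp: equiv_def dest: symD transD)
    \<comment> \<open>In every candidate \<open>F\<close> each element of the block is joined to
      \<open>k\<close>; two such links compose to any pair of the square.\<close>
    have B: "(x, k) \<in> F" if x: "x \<in> ?B" for x
    proof -
      from x consider "x = k" | "x \<in> set ls" | l where "l \<in> set ls" "(l, x) \<in> E" | "(k, x) \<in> E"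
        by blast
      then show ?thesis
      proof cases
        case (3 l)
        then show ?thesis using F(2,4) s t by blast
      qed (use F s in auto)
    qed
    have "?B \<times> ?B \<subseteq> F"
    proof (rule subrelI)
      fix x y assume "(x, y) \<in> ?B \<times> ?B"
      then have "x \<in> ?B" "y \<in> ?B" by (simp_all only: mem_Sigma_iff)
      then show "(x, y) \<in> F" by (rule t[OF B s[OF B]])
    qed
    with F(2) show "?F \<subseteq> F" by (rule Un_least)
  qed
qed

text \<open>Aborted names must be covered as well: a commit leaves \<open>HAb\<close> entries alone,
  so it commits all external names of a class only if none of them has been aborted.\<close>

definition settled :: "('c, 'e) hist \<Rightarrow> 'e set" where
  "settled H = {k. \<exists>i. H i = Some (HAb k) \<or> H i = Some (HCo k)}"

text \<open>
  The class of an aborted or committed name contains no name of the process, and transitions only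
  merge classes that do. So such a class is frozen, and only commits change \<open>co_eq\<close>.
\<close>

fun sane :: "('c, 'n, 'e) conf \<Rightarrow> bool" where
  "sane (E, H, P) \<longleftrightarrow> xconf (E, H, P) \<and>
     (\<forall>k k'. k \<in> settled H \<and> (Extn k, k') \<in> E \<longrightarrow> k' \<notin> ftn P)"

declare xconf.simps [simp del] sane.simps [simp del]

text \<open>The meaning of \<open>FEq\<close> as a relation on names, which allows its invariance to
  be stated without formulae.\<close>

fun co_eq :: "('c, 'n, 'e) conf \<Rightarrow> 'e rel" where
  "co_eq (E, H, P) = {(k, k'). k \<in> Hasco H \<and> k' \<in> Hasco H \<and> (Extn k, Extn k') \<in> E}"

section \<open>Histories under updates\<close>

lemma settled_subset_Htrn: "settled H \<subseteq> Htrn H"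
  unfolding settled_def Htrn_def ran_def by force

lemma Hasco_subset_settled: "Hasco H \<subseteq> settled H"
  unfolding settled_def Hasco_def by auto

lemma Htrn_upd: "i \<notin> dom H \<Longrightarrow> Htrn (H(i \<mapsto> x)) = insert (hname x) (Htrn H)"
  unfolding Htrn_def by (auto simp: dom_def)

lemma Hasco_upd:
  assumes "i \<notin> dom H" "\<And>k. x \<noteq> HCo k"
  shows "Hasco (H(i \<mapsto> x)) = Hasco H"
  using assms unfolding Hasco_def by (auto split: if_splits) (metis option.distinct(1))

lemma settled_upd_HAct: "i \<notin> dom H \<Longrightarrow> settled (H(i \<mapsto> HAct k a)) = settled H"
  unfolding settled_def by (auto split: if_splits)

lemma settled_upd_HAb: "i \<notin> dom H \<Longrightarrow> settled (H(i \<mapsto> HAb k)) = insert k (settled H)"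
  unfolding settled_def by (auto split: if_splits)

lemma hupd_cases:
  assumes "hupd f E k H i = Some x"
  obtains "H i = Some x"
  | k' a where "H i = Some (HAct k' a)" "(Extn k', k) \<in> E" "x = f k'"
  using assms unfolding hupd_def
  by (auto split: option.splits hev.splits if_splits)

lemma hname_hupd:
  assumes "\<And>k. hname (f k) = k"
  shows "map_option hname (hupd f E k H i) = map_option hname (H i)"
  using assms unfolding hupd_def by (auto split: option.splits hev.splits)

lemma Htrn_hupd:
  fixes H :: "('c, 'e) hist"
  assumes "\<And>k. hname (f k) = k"
  shows "Htrn (hupd f E k H) = Htrn H"
proof -
  have Htrn_eq: "Htrn G = {x. \<exists>i. map_option hname (G i) = Some x}" for G :: "('c, 'e) hist"
    unfolding Htrn_def ran_def by auto
  show ?thesis unfolding Htrn_eq hname_hupd[of f, OF assms] ..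
qed

lemma hupd_HCo: "H i = Some (HCo k') \<Longrightarrow> hupd f E k H i = Some (HCo k')"
  unfolding hupd_def by auto

lemma Hasco_hupd_HAb: "Hasco (hupd HAb E k H) = Hasco H"
  unfolding Hasco_def by (auto elim!: hupd_cases intro: hupd_HCo)

lemma settled_hupd:
  assumes "k' \<in> settled (hupd f E k H)" "\<And>k. f k = HAb k \<or> f k = HCo k"
  shows "k' \<in> settled H \<or> (Extn k', k) \<in> E"
proof -
  from assms(1) obtain i x where x: "hupd f E k H i = Some x" "x = HAb k' \<or> x = HCo k'"
    unfolding settled_def by auto
  from x(1) show ?thesis
  proof (cases rule: hupd_cases)
    case 1
    with x(2) show ?thesis unfolding settled_def by auto
  next
    case (2 k'' a)
    then show ?thesis using x(2) assms(2)[of k''] by auto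
  qed
qed

section \<open>The invariant and the committed names along single transitions\<close>

context
  fixes E :: "('n, 'e) trn rel" and H :: "('c, 'e) hist" and P :: "('c, 'n, 'e) proc"
  assumes sane: "sane (E, H, P)"
begin

lemma sane_equiv: "equiv (Field E) E"
  and sane_sym: "(x, y) \<in> E \<Longrightarrow> (y, x) \<in> E"
  and sane_trans: "(x, y) \<in> E \<Longrightarrow> (y, z) \<in> E \<Longrightarrow> (x, z) \<in> E"
  and sane_Extn: "(Extn k, Extn k) \<in> E \<longleftrightarrow> k \<in> Htrn H"
  and sane_Hasco: "(Extn k, Extn k') \<in> E \<Longrightarrow> k \<in> Hasco H \<longleftrightarrow> k' \<in> Hasco H"
  and sane_unique: "(x, y) \<in> E \<Longrightarrow> x \<in> ftn P \<Longrightarrow> y \<in> ftn P \<Longrightarrow> x = y"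
  and sane_settled: "k \<in> settled H \<Longrightarrow> (Extn k, x) \<in> E \<Longrightarrow> x \<notin> ftn P"
  using sane by (auto simp: sane.simps xconf.simps equiv_def dest: symD transD)

lemma sane_reconf_ftn:
  assumes "reconf P \<beta> Q"
  shows "ftn Q \<subseteq> insert (rname \<beta>) (ftn P)"
    "(\<And>k. \<beta> \<noteq> RNew k) \<Longrightarrow> rname \<beta> \<in> ftn P" "(\<And>k. \<beta> \<noteq> RNew k) \<Longrightarrow> rname \<beta> \<notin> ftn Q"
proof -
  have "ftn P1 = {} \<and> ftn P1' = {}" if "subterm (Run P1 k P1') P" for P1 k P1'
  proof -
    have "process P" using sane by (simp add: sane.simps xconf.simps)
    then show ?thesis using that unfolding process_def by blast
  qed
  with reconf_ftn[OF assms]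
  have "ftn Q \<subseteq> insert (rname \<beta>) (ftn P) \<and>
    ((\<forall>k. \<beta> \<noteq> RNew k) \<longrightarrow> rname \<beta> \<in> ftn P \<and> rname \<beta> \<notin> ftn Q)"
    by blast
  then show "ftn Q \<subseteq> insert (rname \<beta>) (ftn P)"
    "(\<And>k. \<beta> \<noteq> RNew k) \<Longrightarrow> rname \<beta> \<in> ftn P" "(\<And>k. \<beta> \<noteq> RNew k) \<Longrightarrow> rname \<beta> \<notin> ftn Q"
    by blast+
qed

text \<open>The update merges only the class of the fresh \<open>k\<close> and classes of names in
  \<open>P\<close>. The invariant keeps settled names out of the latter, so their classes stay as
  they are; and the only name that \<open>Q\<close> can gain is \<open>k\<close>.\<close>

lemma named_step:
  assumes "ptrans P (Named k \<mu>) \<sigma> Q" "fresh_names k E H"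
  shows "E \<subseteq> eqv_upd \<sigma> E"
    and "k0 \<in> Hasco H \<Longrightarrow> (Extn k0, x) \<in> eqv_upd \<sigma> E \<longleftrightarrow> (Extn k0, x) \<in> E"
    and "k0 \<in> settled H \<Longrightarrow> (Extn k0, x) \<in> eqv_upd \<sigma> E \<Longrightarrow> x \<notin> ftn Q"
proof -
  obtain ls where \<sigma>: "\<sigma> = Maps ls k" using ptrans_Named[OF assms(1)] by blast
  have ftn: "set ls \<subseteq> ftn P" "ftn Q \<subseteq> insert k (ftn P)"
    using ptrans_ftn[OF assms(1)] by (auto simp: \<sigma>)
  have fresh: "k \<notin> Field E" "k \<notin> Extn ` Htrn H" using assms(2) by (auto simp: fresh_names_def)
  note eqv = eqv_upd_Maps[OF sane_equiv, of ls k, folded \<sigma>]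
  show sub: "E \<subseteq> eqv_upd \<sigma> E" unfolding eqv by blast
  have *: "(Extn k0, x) \<in> E" if k0: "k0 \<in> settled H" "(Extn k0, x) \<in> eqv_upd \<sigma> E" for k0 x
  proof (rule ccontr)
    assume "(Extn k0, x) \<notin> E"
    \<comment> \<open>A pair outside \<open>E\<close> comes from the new block, so
      \<open>Extn k0\<close> lies in that block. Each way to get there relates a settled name to a
      name of \<open>P\<close> or contradicts the freshness of \<open>k\<close>.\<close>
    with k0 consider "Extn k0 = k" | "Extn k0 \<in> set ls" | l where "l \<in> set ls" "(l, Extn k0) \<in> E"
      | "(k, Extn k0) \<in> E"
      unfolding eqv by blast
    then show False
    proof cases
      case 1
      then show ?thesis using fresh(2) k0(1) by (auto dest: subsetD[OF settled_subset_Htrn])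
    next
      case 2
      then show ?thesis
        using sane_settled[OF k0(1), of "Extn k0"] sane_Extn[of k0] subsetD[OF settled_subset_Htrn k0(1)] ftn(1) by blast
    next
      case (3 l)
      then show ?thesis using sane_settled[OF k0(1) sane_sym] ftn(1) by blast
    next
      case 4
      then show ?thesis using fresh(1) by (auto simp: Field_def)
    qed
  qed
  show "(Extn k0, x) \<in> eqv_upd \<sigma> E \<longleftrightarrow> (Extn k0, x) \<in> E" if "k0 \<in> Hasco H"
    using * subsetD[OF Hasco_subset_settled that] sub by blast
  assume k0: "k0 \<in> settled H" "(Extn k0, x) \<in> eqv_upd \<sigma> E"
  have "x \<noteq> k" using *[OF k0] fresh(1) by (auto simp: Field_def)
  then show "x \<notin> ftn Q" using *[OF k0] sane_settled[OF k0(1)] ftn(2) by blast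
qed

text \<open>Newly settled names lie in the class of \<open>rname \<beta>\<close>. This class meets
  \<open>P\<close> in \<open>rname \<beta>\<close> only, by the uniqueness condition on
  configurations, and \<open>rname \<beta>\<close> does not survive in \<open>Q\<close>.\<close>

lemma hupd_sane:
  assumes "reconf P \<beta> Q" "\<And>k. \<beta> \<noteq> RNew k" "\<And>k. f k = HAb k \<or> f k = HCo k"
    "xconf (E, hupd f E (rname \<beta>) H, Q)"
  shows "sane (E, hupd f E (rname \<beta>) H, Q)"
proof -
  note ftn = sane_reconf_ftn[OF assms(1)]
  have "x \<notin> ftn Q" if k: "k \<in> settled (hupd f E (rname \<beta>) H)" "(Extn k, x) \<in> E" for k x
  proof
    assume x: "x \<in> ftn Q"
    with ftn assms(2) have "x \<in> ftn P" "x \<noteq> rname \<beta>" "rname \<beta> \<in> ftn P" by auto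
    moreover have "k \<in> settled H \<or> (Extn k, rname \<beta>) \<in> E"
      using settled_hupd[OF k(1) assms(3)] .
    ultimately show False
      using sane_settled[OF _ k(2)] sane_unique sane_trans[OF sane_sym k(2)] by blast
  qed
  then show ?thesis using assms(4) unfolding sane.simps by blast
qed

text \<open>Since \<open>k\<close> occurs in \<open>P\<close>, no external name of its class is
  settled; all of them carry \<open>HAct\<close> entries and are committed together. So a commit
  adds one whole class, disjoint from the names committed before.\<close>

lemma commit_facts:
  assumes "reconf P (RCo k) Q" "xconf (E, hupd HCo E k H, Q)"
  shows "sane (E, hupd HCo E k H, Q)"
    and "Hasco (hupd HCo E k H) = Hasco H \<union> Eext E k"
    and "Hasco H \<inter> Eext E k = {}"
    and "co_eq (E, hupd HCo E k H, Q) = co_eq (E, H, P) \<union> Eext E k \<times> Eext E k"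
    and "k1 \<in> Eext E k \<Longrightarrow> k2 \<in> Eext E k \<Longrightarrow> (Extn k1, Extn k2) \<in> E"
proof -
  show "sane (E, hupd HCo E k H, Q)"
    using hupd_sane[OF assms(1)] assms(2) by auto
  have k: "k \<in> ftn P" using sane_reconf_ftn(2)[OF assms(1)] by simp
  have ext: "k' \<in> Eext E k \<longleftrightarrow> (Extn k', k) \<in> E" for k'
    unfolding Eext_def using sane_sym by blast
  have uns: "k' \<notin> settled H" if "k' \<in> Eext E k" for k'
    using that sane_settled k unfolding ext by blast
  show disj: "Hasco H \<inter> Eext E k = {}" using uns Hasco_subset_settled[of H] by blast
  have "k' \<in> Hasco (hupd HCo E k H)" if "k' \<in> Eext E k" for k'
  proof -
    have "k' \<in> Htrn H" using that sane_trans[OF _ sane_sym] sane_Extn unfolding ext by blast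
    then obtain i x where "H i = Some x" "hname x = k'" unfolding Htrn_def ran_def by auto
    moreover from this uns[OF that] obtain a where "x = HAct k' a"
      by (cases x) (auto simp: settled_def)
    ultimately have "hupd HCo E k H i = Some (HCo k')"
      using that by (auto simp: hupd_def ext)
    then show ?thesis unfolding Hasco_def by blast
  qed
  moreover have "Hasco H \<subseteq> Hasco (hupd HCo E k H)"
    unfolding Hasco_def by (auto intro: hupd_HCo)
  moreover have "k' \<in> Hasco H \<union> Eext E k" if "k' \<in> Hasco (hupd HCo E k H)" for k'
    using that unfolding Hasco_def by (auto elim!: hupd_cases simp: ext)
  ultimately show H: "Hasco (hupd HCo E k H) = Hasco H \<union> Eext E k" by blast
  show K: "(Extn k1, Extn k2) \<in> E" if "k1 \<in> Eext E k" "k2 \<in> Eext E k" for k1 k2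
    using that sane_trans[OF _ sane_sym] unfolding ext by blast
  \<comment> \<open>Being committed is uniform on classes, so no pair mixes old and new committed
    names; \<open>co_eq\<close> gains exactly the square.\<close>
  have "(Extn k1, Extn k2) \<notin> E \<and> (Extn k2, Extn k1) \<notin> E"
    if "k1 \<in> Hasco H" "k2 \<in> Eext E k" for k1 k2
    using that disj sane_Hasco by blast
  then show "co_eq (E, hupd HCo E k H, Q) = co_eq (E, H, P) \<union> Eext E k \<times> Eext E k"
    using K sane_sym by (auto simp: H)
qed

text \<open>Without the commit rule no \<open>HCo\<close> entry arises, and the merging of classes
  spares those of committed names.\<close>

lemma core_step_facts:
  assumes "core_step (E, H, P) \<zeta> C'" "xconf C'"
  shows "sane C' \<and> E \<subseteq> fst C' \<and> Hasco (fst (snd C')) = Hasco H \<and> co_eq C' = co_eq (E, H, P)"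
  using assms(1)
proof cases
  case (tau Q)
  have "sane C'"
    using assms(2) ptrans_ftn[OF tau(3)] sane_settled unfolding tau(2) sane.simps by fastforce
  then show ?thesis unfolding tau(2) by simp
next
  case (tau_named k \<sigma> Q)
  note N = named_step[OF tau_named(3,4)]
  have "sane C'" using assms(2) N(3) unfolding tau_named(2) sane.simps by blast
  then show ?thesis using N(1,2) unfolding tau_named(2) by auto
next
  case (new k Q)
  \<comment> \<open>The only name that \<open>Q\<close> can gain is the fresh one, which lies in no
    class at all.\<close>
  have "Intn k \<notin> Field E" using new(4) by (auto simp: fresh_names_def)
  then have "x \<noteq> Intn k" if "(Extn k0, x) \<in> E" for k0 x using that by (auto simp: Field_def)
  then have "x \<notin> ftn Q" if "k0 \<in> settled H" "(Extn k0, x) \<in> E" for k0 x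
    using that sane_reconf_ftn(1)[OF new(3)] sane_settled[OF that] by auto
  then have "sane C'" using assms(2) unfolding new(2) sane.simps by blast
  then show ?thesis unfolding new(2) by simp
next
  case (abort k Q)
  have "sane C'" using hupd_sane[OF abort(3), of HAb] assms(2) unfolding abort(2) by simp
  then show ?thesis unfolding abort(2) by (simp add: Hasco_hupd_HAb)
next
  case (act k a \<sigma> Q i)
  note N = named_step[OF act(3,4)]
  have *: "Hasco (H(i \<mapsto> HAct k a)) = Hasco H" "settled (H(i \<mapsto> HAct k a)) = settled H"
    using act(5) by (simp_all add: Hasco_upd settled_upd_HAct)
  have "sane C'" using assms(2) N(3) unfolding act(2) sane.simps * by blast
  then show ?thesis using N(1,2) * unfolding act(2) by auto
next
  \<comment> \<open>The new class consists of \<open>k\<close> alone and is settled from the start;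
    the rule guarantees that \<open>k\<close> does not occur in \<open>P\<close>.\<close>
  case (act_ab k i a)
  have *: "Hasco (H(i \<mapsto> HAb k)) = Hasco H" "settled (H(i \<mapsto> HAb k)) = insert k (settled H)"
    using act_ab(5) by (simp_all add: Hasco_upd settled_upd_HAb)
  have k: "Extn k \<notin> Field E" "k \<notin> Htrn H" using act_ab(3) by (auto simp: fresh_names_def)
  have "x \<notin> ftn P" if "k0 \<in> insert k (settled H)" "(Extn k0, x) \<in> insert (Extn k, Extn k) E" for k0 x
    using that k sane_settled[of k0 x] act_ab(4) by (auto simp: Field_def)
  then have "sane C'" using assms(2) unfolding act_ab(2) sane.simps * by blast
  moreover have "k \<notin> Hasco H"
    using k(2) Hasco_subset_settled[of H] settled_subset_Htrn[of H] by blast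
  ultimately show ?thesis using * unfolding act_ab(2) by auto
qed

end

section \<open>Renaming of external names in configurations\<close>

lemma mem_map_prod_image: "inj g \<Longrightarrow> (g x, g y) \<in> map_prod g g ` E \<longleftrightarrow> (x, y) \<in> E"
  by (auto dest: injD)

lemma Field_map_prod_image: "Field (map_prod g g ` E) = g ` Field E"
  unfolding Field_def by force

lemma equiv_map_prod_image:
  assumes "inj g" "equiv (Field E) E"
  shows "equiv (g ` Field E) (map_prod g g ` E)"
proof -
  have s: "(x, y) \<in> E \<Longrightarrow> (y, x) \<in> E" and t: "(x, y) \<in> E \<Longrightarrow> (y, z) \<in> E \<Longrightarrow> (x, z) \<in> E"
    and r: "x \<in> Field E \<Longrightarrow> (x, x) \<in> E" for x y z
    using assms(2) by (auto simp: equiv_def refl_on_def dest: symD transD)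
  have "refl_on (g ` Field E) (map_prod g g ` E)"
    using r by (auto simp: refl_on_def Field_def)
  moreover have "sym (map_prod g g ` E)" by (rule symI) (use s in force)
  moreover have "trans (map_prod g g ` E)"
  proof (rule transI)
    fix x y z assume "(x, y) \<in> map_prod g g ` E" "(y, z) \<in> map_prod g g ` E"
    then show "(x, z) \<in> map_prod g g ` E"
      using assms(1) t by (auto dest!: injD)
  qed
  ultimately show ?thesis by (auto simp: equiv_def Field_def)
qed

text \<open>The explicit form is used because an injective map sends block to block. The defining
  intersection is harder to transport: an equivalence above the image of \<open>E\<close> need not
  itself be an image.\<close>

lemma eqv_upd_map_nsub:
  assumes "inj g" "equiv (Field E) E"
  shows "eqv_upd (map_nsub g (Maps ls k)) (map_prod g g ` E) = map_prod g g ` eqv_upd (Maps ls k) E"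
proof -
  have E': "equiv (Field (map_prod g g ` E)) (map_prod g g ` E)"
    using equiv_map_prod_image[OF assms] by (simp add: Field_map_prod_image)
  have im: "(map_prod g g ` E) `` (g ` A) = g ` (E `` A)" for A
    using assms(1) by (force dest: injD)
  have B: "insert (g k) (set (map g ls)) \<union> (map_prod g g ` E) `` set (map g ls) \<union> (map_prod g g ` E) `` {g k}
    = g ` (insert k (set ls) \<union> E `` set ls \<union> E `` {k})"
    using im[of "set ls"] im[of "{k}"] by (simp add: image_Un)
  have "map_prod g g ` (A \<times> A) = g ` A \<times> g ` A" for A by force
  then show ?thesis
    unfolding map_nsub.simps eqv_upd_Maps[OF E'] eqv_upd_Maps[OF assms(2)] B image_Un[of "map_prod g g"]
    by (simp only:)
qed

text \<open>Internal names stay fixed, since they appear neither in labels nor in formulae.\<close>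

abbreviation ptn :: "('e \<Rightarrow> 'e) \<Rightarrow> ('n, 'e) trn \<Rightarrow> ('n, 'e) trn" where
  "ptn \<pi> \<equiv> map_trn id \<pi>"

definition phist :: "('e \<Rightarrow> 'e) \<Rightarrow> ('c, 'e) hist \<Rightarrow> ('c, 'e) hist" where
  "phist \<pi> H = map_option (map_hev id \<pi>) \<circ> H"

fun pconf :: "('e \<Rightarrow> 'e) \<Rightarrow> ('c, 'n, 'e) conf \<Rightarrow> ('c, 'n, 'e) conf" where
  "pconf \<pi> (E, H, P) = (map_prod (ptn \<pi>) (ptn \<pi>) ` E, phist \<pi> H, map_trm (ptn \<pi>) P)"

primrec plab :: "('e \<Rightarrow> 'e) \<Rightarrow> ('c, 'e) xlab \<Rightarrow> ('c, 'e) xlab" where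
  "plab \<pi> XTau = XTau"
| "plab \<pi> (XAct k a) = XAct (\<pi> k) a"
| "plab \<pi> (XCo K) = XCo (\<pi> ` K)"

lemma inj_ptn: "inj \<pi> \<Longrightarrow> inj (ptn \<pi>)"
  by (simp add: trn.inj_map)

lemma Extn_mem_ptn_image: "Extn k \<in> ptn \<pi> ` A \<longleftrightarrow> (\<exists>k'. k = \<pi> k' \<and> Extn k' \<in> A)"
proof
  assume "Extn k \<in> ptn \<pi> ` A"
  then obtain y where y: "Extn k = ptn \<pi> y" "y \<in> A" by blast
  then show "\<exists>k'. k = \<pi> k' \<and> Extn k' \<in> A" by (cases y) auto
qed (auto intro: rev_image_eqI)

lemma Extn_pair_mem_ptn_image:
  assumes "(Extn k, y) \<in> map_prod (ptn \<pi>) (ptn \<pi>) ` E"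
  obtains k' y' where "k = \<pi> k'" "y = ptn \<pi> y'" "(Extn k', y') \<in> E"
proof -
  from assms obtain x' y' where x: "Extn k = ptn \<pi> x'" "y = ptn \<pi> y'" "(x', y') \<in> E" by auto
  then obtain k' where "x' = Extn k'" "k = \<pi> k'" by (cases x') auto
  with x that show ?thesis by blast
qed

lemma hname_map_hev: "hname (map_hev id \<pi> x) = \<pi> (hname x)"
  by (cases x) auto

lemma dom_phist: "dom (phist \<pi> H) = dom H"
  unfolding phist_def dom_def by auto

lemma Htrn_phist: "Htrn (phist \<pi> H) = \<pi> ` Htrn H"
proof -
  have "ran (phist \<pi> H) = map_hev id \<pi> ` ran H" unfolding phist_def ran_def by auto
  then show ?thesis unfolding Htrn_def by (simp add: image_image hname_map_hev)
qed

lemma map_hev_eq_HCo: "map_hev id \<pi> x = HCo k \<longleftrightarrow> (\<exists>k'. x = HCo k' \<and> k = \<pi> k')"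
  by (cases x) auto

lemma Hasco_phist: "Hasco (phist \<pi> H) = \<pi> ` Hasco H"
  unfolding Hasco_def phist_def by (auto simp: map_hev_eq_HCo image_iff)

lemma phist_upd: "phist \<pi> (H(i \<mapsto> x)) = (phist \<pi> H)(i \<mapsto> map_hev id \<pi> x)"
  unfolding phist_def by auto

lemma fresh_names_ptn:
  assumes "inj \<pi>"
  shows "fresh_names (ptn \<pi> k) (map_prod (ptn \<pi>) (ptn \<pi>) ` E) (phist \<pi> H) \<longleftrightarrow> fresh_names k E H"
proof -
  have "ptn \<pi> k \<in> Extn ` Htrn (phist \<pi> H) \<longleftrightarrow> k \<in> Extn ` Htrn H"
    using assms by (cases k) (auto simp: Htrn_phist dest: injD)
  moreover have "ptn \<pi> k \<in> ptn \<pi> ` Field E \<longleftrightarrow> k \<in> Field E"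
    by (rule inj_image_mem_iff[OF inj_ptn[OF assms]])
  ultimately show ?thesis unfolding fresh_names_def Field_map_prod_image by simp
qed

lemma mem_Eext: "k' \<in> Eext E k \<longleftrightarrow> (k, Extn k') \<in> E"
  by (simp add: Eext_def)

lemma Eext_ptn:
  assumes "inj \<pi>"
  shows "Eext (map_prod (ptn \<pi>) (ptn \<pi>) ` E) (ptn \<pi> k) = \<pi> ` Eext E k"
proof (rule set_eqI)
  fix k'
  show "k' \<in> Eext (map_prod (ptn \<pi>) (ptn \<pi>) ` E) (ptn \<pi> k) \<longleftrightarrow> k' \<in> \<pi> ` Eext E k"
  proof
    assume "k' \<in> Eext (map_prod (ptn \<pi>) (ptn \<pi>) ` E) (ptn \<pi> k)"
    then obtain x y where x: "ptn \<pi> k = ptn \<pi> x" "Extn k' = ptn \<pi> y" "(x, y) \<in> E"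
      by (auto simp: mem_Eext)
    from x(2) obtain l where l: "y = Extn l" "k' = \<pi> l" by (cases y) auto
    have "k = x" using inj_ptn[OF assms] x(1) by (rule injD)
    with x(3) l have "l \<in> Eext E k" by (simp add: mem_Eext)
    with l(2) show "k' \<in> \<pi> ` Eext E k" by blast
  next
    assume "k' \<in> \<pi> ` Eext E k"
    then obtain l where "k' = \<pi> l" "(k, Extn l) \<in> E" by (auto simp: mem_Eext)
    then show "k' \<in> Eext (map_prod (ptn \<pi>) (ptn \<pi>) ` E) (ptn \<pi> k)"
      using mem_map_prod_image[OF inj_ptn[OF assms], of k "Extn l" E] by (simp add: mem_Eext)
  qed
qed

lemma hupd_ptn:
  assumes "inj \<pi>" "\<And>k. map_hev id \<pi> (f k) = f (\<pi> k)"
  shows "hupd f (map_prod (ptn \<pi>) (ptn \<pi>) ` E) (ptn \<pi> k) (phist \<pi> H) = phist \<pi> (hupd f E k H)"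
proof
  fix i
  have "(Extn (\<pi> k'), ptn \<pi> k) \<in> map_prod (ptn \<pi>) (ptn \<pi>) ` E \<longleftrightarrow> (Extn k', k) \<in> E" for k'
    using mem_map_prod_image[OF inj_ptn[OF assms(1)], of "Extn k'" k E] by simp
  then show "hupd f (map_prod (ptn \<pi>) (ptn \<pi>) ` E) (ptn \<pi> k) (phist \<pi> H) i = phist \<pi> (hupd f E k H) i"
    unfolding hupd_def phist_def comp_def using assms(2) by (auto split: option.splits hev.splits)
qed

lemma xconf_pconf:
  fixes C :: "('c, 'n, 'e) conf"
  assumes "inj \<pi>" "xconf C"
  shows "xconf (pconf \<pi> C)"
proof -
  obtain E H P where C: "C = (E, H, P)" by (cases C)
  let ?g = "ptn \<pi> :: ('n, 'e) trn \<Rightarrow> ('n, 'e) trn"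
  let ?E = "map_prod ?g ?g ` E"
  note g = inj_ptn[OF assms(1)]
  have x: "process P" "equiv (Field E) E" "finite (Field E)" "finite (dom H)"
    "\<And>i j x y. H i = Some x \<Longrightarrow> H j = Some y \<Longrightarrow> hname x = hname y \<Longrightarrow> i = j"
    "\<And>k. (Extn k, Extn k) \<in> E \<longleftrightarrow> k \<in> Htrn H"
    "\<And>k k'. (Extn k, Extn k') \<in> E \<Longrightarrow> k \<in> Hasco H \<longleftrightarrow> k' \<in> Hasco H"
    "ftn P \<inter> Extn ` Hasco H = {}"
    "\<And>k k'. (k, k') \<in> E \<Longrightarrow> k \<in> ftn P \<Longrightarrow> k' \<in> ftn P \<Longrightarrow> k = k'"
    "ftn P \<inter> range Extn \<subseteq> Extn ` Htrn H"
    using assms(2) unfolding C by (auto simp: xconf.simps)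
  have 1: "i = j" if "phist \<pi> H i = Some x" "phist \<pi> H j = Some y" "hname x = hname y" for i j x y
    using that x(5) injD[OF assms(1)] by (auto simp: phist_def hname_map_hev)
  have 2: "(Extn k, Extn k) \<in> ?E \<longleftrightarrow> k \<in> \<pi> ` Htrn H" for k
  proof
    assume "(Extn k, Extn k) \<in> ?E"
    then show "k \<in> \<pi> ` Htrn H"
    proof (rule Extn_pair_mem_ptn_image)
      fix k' y' assume k: "k = \<pi> k'" "Extn k = ptn \<pi> y'" "(Extn k', y') \<in> E"
      then have "y' = Extn k'" using injD[OF assms(1)] by (cases y') auto
      with k x(6) show ?thesis by auto
    qed
  next
    assume "k \<in> \<pi> ` Htrn H"
    then show "(Extn k, Extn k) \<in> ?E" using x(6) by (force intro: rev_image_eqI)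
  qed
  have 3: "k \<in> \<pi> ` Hasco H \<longleftrightarrow> k' \<in> \<pi> ` Hasco H" if "(Extn k, Extn k') \<in> ?E" for k k'
    using that
  proof (rule Extn_pair_mem_ptn_image)
    fix l y assume k: "k = \<pi> l" "Extn k' = ptn \<pi> y" "(Extn l, y) \<in> E"
    then obtain l' where "y = Extn l'" "k' = \<pi> l'" by (cases y) auto
    with k x(7) show ?thesis using assms(1) by (simp add: inj_image_mem_iff)
  qed
  have 4: "?g ` ftn P \<inter> Extn ` \<pi> ` Hasco H = {}"
  proof (rule ccontr)
    assume "?g ` ftn P \<inter> Extn ` \<pi> ` Hasco H \<noteq> {}"
    then obtain y where y: "y \<in> ?g ` ftn P" "y \<in> Extn ` \<pi> ` Hasco H" by blast
    from y(2) obtain k where "k \<in> Hasco H" "y = Extn (\<pi> k)" by auto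
    with y(1) have k: "k \<in> Hasco H" "Extn (\<pi> k) \<in> ?g ` ftn P" by simp_all
    then obtain k' where "\<pi> k = \<pi> k'" "Extn k' \<in> ftn P" unfolding Extn_mem_ptn_image by blast
    with k x(8) injD[OF assms(1)] show False by blast
  qed
  have 5: "k = k'" if k: "(k, k') \<in> ?E" "k \<in> ?g ` ftn P" "k' \<in> ?g ` ftn P" for k k'
  proof -
    from k(1) obtain a b where ab: "k = ?g a" "k' = ?g b" "(a, b) \<in> E" by auto
    with k(2,3) have "a \<in> ftn P" "b \<in> ftn P" by (simp_all add: inj_image_mem_iff[OF g])
    with ab x(9) show ?thesis by blast
  qed
  have 6: "?g ` ftn P \<inter> range Extn \<subseteq> Extn ` \<pi> ` Htrn H"
  proof
    fix y assume "y \<in> ?g ` ftn P \<inter> range Extn"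
    then obtain k where k: "y = Extn k" "Extn k \<in> ?g ` ftn P" by (elim IntE rangeE) simp
    then obtain k' where "k = \<pi> k'" "Extn k' \<in> ftn P" unfolding Extn_mem_ptn_image by blast
    with k x(10) show "y \<in> Extn ` \<pi> ` Htrn H" by blast
  qed
  have 7: "process (map_trm ?g P)" "equiv (Field ?E) ?E" "finite (Field ?E)" "finite (dom (phist \<pi> H))"
    using process_map_trm[OF x(1)] equiv_map_prod_image[OF g x(2)] x(3,4)
    by (simp_all add: Field_map_prod_image dom_phist)
  show ?thesis
    unfolding C pconf.simps xconf.simps trm.set_map Htrn_phist Hasco_phist
  proof (intro conjI allI impI)
    show "i = j" if "phist \<pi> H i = Some x \<and> phist \<pi> H j = Some y \<and> hname x = hname y" for i j x y
      using that by (elim conjE) (rule 1)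
    show "k = k'" if "(k, k') \<in> ?E \<and> k \<in> ?g ` ftn P \<and> k' \<in> ?g ` ftn P" for k k'
      using that by (elim conjE) (rule 5)
  qed (fact 2 3 4 6 7)+
qed

section \<open>Equivariance of single transitions\<close>

lemma core_step_pconf:
  assumes "inj \<pi>" "core_step C \<zeta> C'" "xconf C"
  shows "core_step (pconf \<pi> C) (plab \<pi> \<zeta>) (pconf \<pi> C')"
proof -
  note g = inj_ptn[OF assms(1)]
  have eqv: "eqv_upd (map_nsub (ptn \<pi>) \<sigma>) (map_prod (ptn \<pi>) (ptn \<pi>) ` E)
      = map_prod (ptn \<pi>) (ptn \<pi>) ` eqv_upd \<sigma> E"
    if C: "C = (E, H, P)" and pt: "ptrans P (Named k \<mu>) \<sigma> Q" for E H P k \<mu> \<sigma> Q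
  proof -
    have "equiv (Field E) E" using assms(3) C by (simp add: xconf.simps)
    moreover obtain ls where "\<sigma> = Maps ls k" using ptrans_Named[OF pt] by blast
    ultimately show ?thesis using eqv_upd_map_nsub[OF g] by simp
  qed
  show ?thesis
    using assms(2)
  proof cases
    case (tau P Q E H)
    then show ?thesis using ptrans_map_trm[OF g tau(4)] by (auto intro: core_step.tau)
  next
    case (tau_named P k \<sigma> Q E H)
    have "ptrans (map_trm (ptn \<pi>) P) (Named (Intn k) Tau) (map_nsub (ptn \<pi>) \<sigma>) (map_trm (ptn \<pi>) Q)"
      using ptrans_map_trm[OF g tau_named(4)] by simp
    moreover have "fresh_names (Intn k) (map_prod (ptn \<pi>) (ptn \<pi>) ` E) (phist \<pi> H)"
      using fresh_names_ptn[OF assms(1), of "Intn k" E H] tau_named(5) by simp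
    ultimately show ?thesis
      using core_step.tau_named eqv[OF tau_named(1,4)] unfolding tau_named(1-3) by fastforce
  next
    case (new P k Q E H)
    have "reconf (map_trm (ptn \<pi>) P) (RNew (Intn k)) (map_trm (ptn \<pi>) Q)"
      using reconf_map_trm[OF g new(4)] by simp
    moreover have "fresh_names (Intn k) (map_prod (ptn \<pi>) (ptn \<pi>) ` E) (phist \<pi> H)"
      using fresh_names_ptn[OF assms(1), of "Intn k" E H] new(5) by simp
    ultimately show ?thesis
      using core_step.new unfolding new(1-3) by fastforce
  next
    case (abort P k Q E H)
    have "reconf (map_trm (ptn \<pi>) P) (RAb (ptn \<pi> k)) (map_trm (ptn \<pi>) Q)"
      using reconf_map_trm[OF g abort(4)] by simp
    from core_step.abort[OF this] show ?thesis
      unfolding abort(1-3) pconf.simps plab.simps hupd_ptn[of \<pi> HAb, OF assms(1) hev.map(2), symmetric] .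
  next
    case (act P k a \<sigma> Q E H i)
    have "ptrans (map_trm (ptn \<pi>) P) (Named (Extn (\<pi> k)) (Act (map_act Free a)))
        (map_nsub (ptn \<pi>) \<sigma>) (map_trm (ptn \<pi>) Q)"
      using ptrans_map_trm[OF g act(4)] by simp
    moreover have "fresh_names (Extn (\<pi> k)) (map_prod (ptn \<pi>) (ptn \<pi>) ` E) (phist \<pi> H)"
      using fresh_names_ptn[OF assms(1), of "Extn k" E H] act(5) by simp
    moreover have "i \<notin> dom (phist \<pi> H)" using act(6) by (simp add: dom_phist)
    ultimately show ?thesis
      using core_step.act eqv[OF act(1,4)] unfolding act(1-3) pconf.simps plab.simps phist_upd hev.map act.map_id
      by metis
  next
    case (act_ab k E H P i a)
    have "fresh_names (Extn (\<pi> k)) (map_prod (ptn \<pi>) (ptn \<pi>) ` E) (phist \<pi> H)"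
      using fresh_names_ptn[OF assms(1), of "Extn k" E H] act_ab(4) by simp
    moreover have "Extn (\<pi> k) \<notin> ftn (map_trm (ptn \<pi>) P)"
      using act_ab(5) injD[OF assms(1)] by (auto simp: trm.set_map Extn_mem_ptn_image)
    moreover have "i \<notin> dom (phist \<pi> H)" using act_ab(6) by (simp add: dom_phist)
    ultimately have "core_step (map_prod (ptn \<pi>) (ptn \<pi>) ` E, phist \<pi> H, map_trm (ptn \<pi>) P)
      (XAct (\<pi> k) a) (insert (Extn (\<pi> k), Extn (\<pi> k)) (map_prod (ptn \<pi>) (ptn \<pi>) ` E),
        (phist \<pi> H)(i \<mapsto> HAb (\<pi> k)), map_trm (ptn \<pi>) P)"
      by (rule core_step.act_ab)
    then show ?thesis unfolding act_ab(1-3) by (simp add: phist_upd)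
  qed
qed

lemma ext_step_pconf:
  assumes "inj \<pi>" "ext_step C \<zeta> C'"
  shows "ext_step (pconf \<pi> C) (plab \<pi> \<zeta>) (pconf \<pi> C')"
proof -
  have x: "xconf C" "xconf C'" "ext_rule C \<zeta> C'" using assms(2) by (auto simp: ext_step_def)
  from x(3) have "ext_rule (pconf \<pi> C) (plab \<pi> \<zeta>) (pconf \<pi> C')"
  proof cases
    case core
    then show ?thesis using core_step_pconf[OF assms(1) _ x(1)] ext_rule.core by blast
  next
    case (commit P k Q E H)
    have "reconf (map_trm (ptn \<pi>) P) (RCo (ptn \<pi> k)) (map_trm (ptn \<pi>) Q)"
      using reconf_map_trm[OF inj_ptn[OF assms(1)] commit(4)] by simp
    from ext_rule.commit[OF this] show ?thesis
      unfolding commit(1-3) pconf.simps plab.simps hupd_ptn[of \<pi> HCo, OF assms(1) hev.map(3), symmetric] .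
  qed
  then show ?thesis using xconf_pconf[OF assms(1) x(1)] xconf_pconf[OF assms(1) x(2)] x by (simp add: ext_step_def)
qed

lemma cs_step_pconf:
  assumes "inj \<pi>" "cs_step C \<zeta> C'"
  shows "cs_step (pconf \<pi> C) (plab \<pi> \<zeta>) (pconf \<pi> C')"
proof -
  have x: "xconf C" "xconf C'" "cs_rule C \<zeta> C'" using assms(2) by (auto simp: cs_step_def)
  have re: "reconf (map_trm (ptn \<pi>) P) (RCo (ptn \<pi> k)) (map_trm (ptn \<pi>) Q)"
    if "reconf P (RCo k) Q" for P k Q
    using reconf_map_trm[OF inj_ptn[OF assms(1)] that] by simp
  from x(3) have "cs_rule (pconf \<pi> C) (plab \<pi> \<zeta>) (pconf \<pi> C')"
  proof cases
    case core
    then show ?thesis using core_step_pconf[OF assms(1) _ x(1)] cs_rule.core by blast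
  next
    case (commit_ext P k Q E H)
    from cs_rule.commit_ext[OF re[OF commit_ext(4)], of "map_prod (ptn \<pi>) (ptn \<pi>) ` E" "phist \<pi> H"]
    show ?thesis
      using commit_ext(5)
      unfolding commit_ext(1-3) pconf.simps plab.simps Eext_ptn[OF assms(1)]
        hupd_ptn[of \<pi> HCo, OF assms(1) hev.map(3), symmetric] by simp
  next
    case (commit_int P k Q E H)
    from cs_rule.commit_int[OF re[OF commit_int(4)], of "map_prod (ptn \<pi>) (ptn \<pi>) ` E" "phist \<pi> H"]
    show ?thesis
      using commit_int(5)
      unfolding commit_int(1-3) pconf.simps plab.simps Eext_ptn[OF assms(1)]
        hupd_ptn[of \<pi> HCo, OF assms(1) hev.map(3), symmetric] by simp
  qed
  then show ?thesis using xconf_pconf[OF assms(1) x(1)] xconf_pconf[OF assms(1) x(2)] x by (simp add: cs_step_def)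
qed

section \<open>Formulae and their logical equivalences\<close>

declare split_paired_Ex [simp del] split_paired_All [simp del]

lemma form_induct [case_names Tau Act Neg Conj Hasco Eq Co]:
  assumes "\<And>\<phi>. \<Phi> \<phi> \<Longrightarrow> \<Phi> (FTau \<phi>)" "\<And>x a \<phi>. \<Phi> \<phi> \<Longrightarrow> \<Phi> (FAct x a \<phi>)" "\<And>\<phi>. \<Phi> \<phi> \<Longrightarrow> \<Phi> (FNeg \<phi>)"
    "\<And>G. (\<And>i \<phi>. G i = Some \<phi> \<Longrightarrow> \<Phi> \<phi>) \<Longrightarrow> \<Phi> (FConj G)"
    "\<And>v. \<Phi> (FHasco v)" "\<And>v1 v2. \<Phi> (FEq v1 v2)" "\<And>K \<phi>. \<Phi> \<phi> \<Longrightarrow> \<Phi> (FCo K \<phi>)"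
  shows "\<Phi> \<phi>"
proof (induction \<phi>)
  case (FConj G)
  then show ?case by (intro assms(4)) (metis option.set_intros rangeI)
qed (simp_all add: assms(1-3,5-7))

text \<open>All instances \<open>fsub x l \<phi>\<close> share the \<open>skel\<close> of
  \<open>\<phi>\<close>, so induction along \<open>skel\<close> follows the way in which
  \<open>sat\<close> unfolds \<open>FAct\<close>.\<close>

lemma form_fsub_induct [case_names Tau Act Neg Conj Hasco Eq Co]:
  fixes \<phi> :: "('c, 'e, 'i) form"
  assumes "\<And>\<phi>. \<Phi> \<phi> \<Longrightarrow> \<Phi> (FTau \<phi>)" "\<And>x a \<phi>. (\<And>l. \<Phi> (fsub x l \<phi>)) \<Longrightarrow> \<Phi> (FAct x a \<phi>)"
    "\<And>\<phi>. \<Phi> \<phi> \<Longrightarrow> \<Phi> (FNeg \<phi>)"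
    "\<And>G. (\<And>i \<phi>. G i = Some \<phi> \<Longrightarrow> \<Phi> \<phi>) \<Longrightarrow> \<Phi> (FConj G)"
    "\<And>v. \<Phi> (FHasco v)" "\<And>v1 v2. \<Phi> (FEq v1 v2)" "\<And>K \<phi>. \<Phi> \<phi> \<Longrightarrow> \<Phi> (FCo K \<phi>)"
  shows "\<Phi> \<phi>"
proof -
  have "wf (inv_image isub skel :: (('c, 'e, 'i) form \<times> ('c, 'e, 'i) form) set)"
    by (rule wf_inv_image[OF wf_isub])
  then show ?thesis
  proof (induction \<phi> rule: wf_induct_rule)
    case (less \<phi>)
    show ?case
    proof (cases \<phi>)
      case (FTau \<psi>)
      have "\<Phi> \<psi>" using less FTau by (auto intro: isub.intros)
      then show ?thesis unfolding FTau by (rule assms(1))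
    next
      case (FAct x a \<psi>)
      have "(skel (fsub x l \<psi>), skel \<phi>) \<in> isub" for l
        unfolding FAct skel_fsub skel.simps by (rule isub.intros)
      then have "\<Phi> (fsub x l \<psi>)" for l using less by simp
      then show ?thesis unfolding FAct by (rule assms(2))
    next
      case (FNeg \<psi>)
      have "\<Phi> \<psi>" using less FNeg by (auto intro: isub.intros)
      then show ?thesis unfolding FNeg by (rule assms(3))
    next
      case (FConj G)
      have "\<Phi> \<psi>" if "G i = Some \<psi>" for i \<psi> using less FConj that by (auto intro!: isub.intros(4)[of _ i])
      then show ?thesis unfolding FConj by (rule assms(4))
    next
      case (FCo K \<psi>)
      have "\<Phi> \<psi>" using less FCo by (auto intro: isub.intros)
      then show ?thesis unfolding FCo by (rule assms(7))
    qed (simp_all add: assms(5,6))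
  qed
qed

section \<open>Names in formulae and their replacement\<close>

primrec fnames :: "('c, 'e, 'i) form \<Rightarrow> 'e set" where
  "fnames (FTau \<phi>) = fnames \<phi>"
| "fnames (FAct x a \<phi>) = fnames \<phi>"
| "fnames (FNeg \<phi>) = fnames \<phi>"
| "fnames (FConj G) = (\<Union>i. \<Union>(set_option (map_option fnames (G i))))"
| "fnames (FHasco v) = {k. v = Nm k}"
| "fnames (FEq v1 v2) = {k. v1 = Nm k \<or> v2 = Nm k}"
| "fnames (FCo K \<phi>) = {k. Nm k \<in> K} \<union> fnames \<phi>"

text \<open>
  \<open>gmap g\<close> replaces names by values. It shifts all variables, the binders included, so that a name
  can be replaced by the variable \<open>Vr 0\<close> without capture, even in a formula that uses every variable.
\<close>

primrec gval :: "('e \<Rightarrow> 'e val) \<Rightarrow> 'e val \<Rightarrow> 'e val" where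
  "gval g (Nm k) = g k"
| "gval g (Vr x) = Vr (Suc x)"

primrec gmap :: "('e \<Rightarrow> 'e val) \<Rightarrow> ('c, 'e, 'i) form \<Rightarrow> ('c, 'e, 'i) form" where
  "gmap g (FTau \<phi>) = FTau (gmap g \<phi>)"
| "gmap g (FAct x a \<phi>) = FAct (Suc x) a (gmap g \<phi>)"
| "gmap g (FNeg \<phi>) = FNeg (gmap g \<phi>)"
| "gmap g (FConj G) = FConj (\<lambda>i. map_option (gmap g) (G i))"
| "gmap g (FHasco v) = FHasco (gval g v)"
| "gmap g (FEq v1 v2) = FEq (gval g v1) (gval g v2)"
| "gmap g (FCo K \<phi>) = FCo (gval g ` K) (gmap g \<phi>)"

lemma gval_cong: "(\<And>k. v = Nm k \<Longrightarrow> g k = h k) \<Longrightarrow> gval g v = gval h v"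
  by (cases v) auto

lemma gmap_cong: "(\<And>k. k \<in> fnames \<phi> \<Longrightarrow> g k = h k) \<Longrightarrow> gmap g \<phi> = gmap h \<phi>"
proof (induction \<phi> rule: form_induct)
  case (Conj G)
  have "gmap g \<psi> = gmap h \<psi>" if "G i = Some \<psi>" for i \<psi>
    using Conj that by (metis UN_I UNIV_I UnionI fnames.simps(4) option.set_intros option.simps(9))
  then show ?case by (auto simp: fun_eq_iff intro!: option.map_cong0 dest: option.set_cases)
next
  case (Co K \<phi>)
  have "gval g ` K = gval h ` K"
    by (rule image_cong) (use Co.prems in \<open>auto intro!: gval_cong\<close>)
  then show ?case using Co by simp
qed (auto intro!: gval_cong)

text \<open>The shift has freed variable \<open>0\<close>: its only occurrences are those that
  \<open>g\<close> introduces, and no binder captures them. Instantiating it thus amounts to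
  changing \<open>g\<close>.\<close>

lemma fsub_0_gmap: "fsub 0 l (gmap g \<phi>) = gmap (\<lambda>k. vsub 0 l (g k)) \<phi>"
proof (induction \<phi> rule: form_induct)
  case (Conj G)
  then show ?case by (auto simp: fun_eq_iff option.map_comp intro!: map_option_cong_Some)
next
  case (Hasco v)
  then show ?case by (cases v) (auto simp: vsub_def)
next
  case (Eq v1 v2)
  then show ?case by (cases v1; cases v2) (auto simp: vsub_def)
next
  case (Co K \<phi>)
  have "vsub 0 l (gval g v) = gval (\<lambda>k. vsub 0 l (g k)) v" for v by (cases v) (auto simp: vsub_def)
  then show ?case using Co by (simp add: image_image comp_def)
qed auto

text \<open>Serves to push a renaming of names through the instances by which \<open>sat\<close>
  unfolds \<open>FAct\<close>.\<close>

lemma fsub_Suc_gmap: "fsub (Suc x) (\<pi> l) (gmap (\<lambda>k. Nm (\<pi> k)) \<phi>) = gmap (\<lambda>k. Nm (\<pi> k)) (fsub x l \<phi>)"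
proof (induction \<phi> rule: form_induct)
  case (Conj G)
  then show ?case by (auto simp: fun_eq_iff option.map_comp intro!: map_option_cong_Some)
next
  case (Hasco v)
  then show ?case by (cases v) (auto simp: vsub_def)
next
  case (Eq v1 v2)
  then show ?case by (cases v1; cases v2) (auto simp: vsub_def)
next
  case (Co K \<phi>)
  have "vsub (Suc x) (\<pi> l) (gval (\<lambda>k. Nm (\<pi> k)) v) = gval (\<lambda>k. Nm (\<pi> k)) (vsub x l v)" for v
    by (cases v) (auto simp: vsub_def)
  then show ?case using Co by (simp add: image_image comp_def)
qed auto

lemma fv_gmap: "fv (gmap g \<phi>) \<subseteq> Suc ` fv \<phi> \<union> {x. \<exists>k\<in>fnames \<phi>. g k = Vr x}"
proof (induction \<phi> rule: form_induct)
  case (Conj G)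
  show ?case
  proof
    fix x assume "x \<in> fv (gmap g (FConj G))"
    then obtain i \<psi> where \<psi>: "G i = Some \<psi>" "x \<in> fv (gmap g \<psi>)" by (auto elim!: option.set_cases)
    moreover have "fv \<psi> \<subseteq> fv (FConj G)" "fnames \<psi> \<subseteq> fnames (FConj G)"
      using \<psi>(1) by (force simp: option.set_map)+
    ultimately show "x \<in> Suc ` fv (FConj G) \<union> {x. \<exists>k\<in>fnames (FConj G). g k = Vr x}"
      using Conj[OF \<psi>(1)] by blast
  qed
next
  case (Hasco v)
  then show ?case by (cases v) auto
next
  case (Eq v1 v2)
  then show ?case by (cases v1; cases v2) auto
next
  case (Co K \<phi>)
  have "(\<exists>y. x = Suc y \<and> Vr y \<in> K) \<or> (\<exists>k. Nm k \<in> K \<and> g k = Vr x)" if "Vr x \<in> gval g ` K" for x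
  proof -
    from that obtain v where "v \<in> K" "Vr x = gval g v" by blast
    then show ?thesis by (cases v) auto
  qed
  then have "x \<in> Suc ` fv (FCo K \<phi>) \<union> {x. \<exists>k\<in>fnames (FCo K \<phi>). g k = Vr x}"
    if "Vr x \<in> gval g ` K" for x
    using that by fastforce
  moreover have "fv (gmap g \<phi>) \<subseteq> Suc ` fv (FCo K \<phi>) \<union> {x. \<exists>k\<in>fnames (FCo K \<phi>). g k = Vr x}"
    using Co by auto
  ultimately show ?case unfolding gmap.simps fv.simps(7)[of "gval g ` K"] by blast
qed auto

lemma fnames_gmap: "fnames (gmap g \<phi>) \<subseteq> {k'. \<exists>k\<in>fnames \<phi>. g k = Nm k'}"
proof (induction \<phi> rule: form_induct)
  case (Conj G)
  show ?case
  proof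
    fix k assume "k \<in> fnames (gmap g (FConj G))"
    then obtain i \<psi> where \<psi>: "G i = Some \<psi>" "k \<in> fnames (gmap g \<psi>)" by (auto elim!: option.set_cases)
    moreover have "fnames \<psi> \<subseteq> fnames (FConj G)"
      using \<psi>(1) by (force simp: option.set_map)
    ultimately show "k \<in> {k'. \<exists>k\<in>fnames (FConj G). g k = Nm k'}"
      using Conj[OF \<psi>(1)] by blast
  qed
next
  case (Hasco v)
  then show ?case by (cases v) auto
next
  case (Eq v1 v2)
  then show ?case by (cases v1; cases v2) auto
next
  case (Co K \<phi>)
  have "\<exists>k. Nm k \<in> K \<and> g k = Nm k'" if "Nm k' \<in> gval g ` K" for k'
  proof -
    from that obtain v where "v \<in> K" "Nm k' = gval g v" by blast
    then show ?thesis by (cases v) auto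
  qed
  then show ?case using Co by auto
qed auto

section \<open>Recorded names, weak transitions and the exchange of fresh names\<close>

abbreviation cnames :: "('c, 'n, 'e) conf \<Rightarrow> 'e set" where
  "cnames C \<equiv> Htrn (fst (snd C))"

text \<open>The names that a transition adds to the history. A commit changes entries but adds
  none.\<close>

primrec lnames :: "('c, 'e) xlab \<Rightarrow> 'e set" where
  "lnames XTau = {}"
| "lnames (XAct k a) = {k}"
| "lnames (XCo K) = {}"

lemma sane_xconf: "sane C \<Longrightarrow> xconf C"
  by (cases C) (simp add: sane.simps)

lemma weak_cases:
  assumes "weak step C \<zeta> C'"
  obtains "\<zeta> = XTau" "(\<lambda>D D'. step D XTau D')\<^sup>*\<^sup>* C C'"
  | D D' where "\<zeta> \<noteq> XTau" "(\<lambda>D D'. step D XTau D')\<^sup>*\<^sup>* C D" "step D \<zeta> D'"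
      "(\<lambda>D D'. step D XTau D')\<^sup>*\<^sup>* D' C'"
  using assms unfolding weak_def Let_def by (cases "\<zeta> = XTau") auto

text \<open>The induction principle for weak transitions: a relation that contains the steps and
  absorbs silent moves on both sides contains the weak transitions.\<close>

lemma weak_lift:
  assumes "weak step C \<zeta> C'"
    and "\<And>D. R D XTau D" "\<And>D \<zeta> D'. step D \<zeta> D' \<Longrightarrow> R D \<zeta> D'"
    and "\<And>D \<zeta> D' D''. R D \<zeta> D' \<Longrightarrow> R D' XTau D'' \<Longrightarrow> R D \<zeta> D''"
    and "\<And>D \<zeta> D' D''. R D XTau D' \<Longrightarrow> R D' \<zeta> D'' \<Longrightarrow> R D \<zeta> D''"
  shows "R C \<zeta> C'"
proof -
  have taus: "R D XTau D'" if "(\<lambda>D D'. step D XTau D')\<^sup>*\<^sup>* D D'" for D D'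
    using that by induction (use assms(2-4) in blast)+
  from assms(1) show ?thesis
  proof (cases rule: weak_cases)
    case 1
    then show ?thesis using taus by simp
  next
    case (2 D D')
    show ?thesis
      by (rule assms(4)[OF assms(5)[OF taus[OF 2(2)] assms(3)[OF 2(3)]] taus[OF 2(4)]])
  qed
qed

lemma weak_tau_refl: "weak step C XTau C"
  by (simp add: weak_def)

lemma weak_step: "step C \<zeta> C' \<Longrightarrow> weak step C \<zeta> C'"
  unfolding weak_def Let_def by (metis (mono_tags, lifting) r_into_rtranclp rtranclp.rtrancl_refl)

lemma weak_tauL: "weak step C XTau D \<Longrightarrow> weak step D \<zeta> C' \<Longrightarrow> weak step C \<zeta> C'"
  unfolding weak_def Let_def by (auto split: if_splits) (meson rtranclp_trans)

lemma weak_tauR: "weak step C \<zeta> D \<Longrightarrow> weak step D XTau C' \<Longrightarrow> weak step C \<zeta> C'"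
  unfolding weak_def Let_def by (auto split: if_splits) (meson rtranclp_trans)

lemma pconf_transpose_invol:
  fixes C :: "('c, 'n, 'e) conf"
  shows "pconf (transpose a b) (pconf (transpose a b) C) = C"
proof -
  obtain E H P where C: "C = (E, H, P)" by (cases C)
  have [simp]: "ptn (transpose a b) (ptn (transpose a b) x) = x" for x
    by (simp add: trn.map_comp trn.map_ident comp_def trn.map_id0[unfolded id_def, THEN fun_cong])
  have "map_hev id (transpose a b) (map_hev id (transpose a b) x) = x" for x :: "('c, 'e) hev"
    by (cases x) (auto simp: act.map_id)
  then have "phist (transpose a b) (phist (transpose a b) H) = H"
    unfolding phist_def by (auto simp: fun_eq_iff option.map_comp comp_def option.map_ident)
  moreover have "map_trm (ptn (transpose a b)) (map_trm (ptn (transpose a b)) P) = P"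
    by (simp add: trm.map_comp comp_def trm.map_ident)
  ultimately show ?thesis unfolding C by (simp add: image_image map_prod_def case_prod_beta)
qed

text \<open>The history records every external name of the equivalence and of the process, so the
  exchange of two unrecorded names moves nothing.\<close>

lemma pconf_transpose_fresh:
  assumes "xconf C" "a \<notin> cnames C" "b \<notin> cnames C"
  shows "pconf (transpose a b) C = C"
proof -
  obtain E H P where C: "C = (E, H, P)" by (cases C)
  have names: "k \<in> Htrn H" if "Extn k \<in> Field E \<or> Extn k \<in> ftn P" for k
    using that
  proof
    assume "Extn k \<in> Field E"
    moreover have "equiv (Field E) E" using assms(1) unfolding C by (simp add: xconf.simps)
    ultimately have "(Extn k, Extn k) \<in> E" by (simp add: equiv_def refl_on_def)
    then show ?thesis using assms(1) unfolding C by (simp add: xconf.simps)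
  next
    assume "Extn k \<in> ftn P"
    then show ?thesis using assms(1) unfolding C by (auto simp: xconf.simps)
  qed
  have fixn: "transpose a b k = k" if "k \<in> Htrn H" for k
    using that assms(2,3) unfolding C by (auto simp: transpose_def)
  have ptn: "ptn (transpose a b) x = x" if "x \<in> Field E \<or> x \<in> ftn P" for x
    using that names fixn by (cases x) auto
  have "map_prod (ptn (transpose a b)) (ptn (transpose a b)) ` E = id ` E"
    by (rule image_cong) (auto simp: ptn FieldI1 FieldI2)
  moreover have "phist (transpose a b) H i = H i" for i
  proof (cases "H i")
    case (Some x)
    then have "hname x \<in> Htrn H" by (auto simp: Htrn_def ran_def)
    then have "map_hev id (transpose a b) x = x" using fixn by (cases x) (auto simp: act.map_id)
    with Some show ?thesis by (simp add: phist_def)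
  qed (simp add: phist_def)
  moreover have "map_trm (ptn (transpose a b)) P = map_trm id P"
    by (rule trm.map_cong0) (simp add: ptn)
  ultimately show ?thesis unfolding C by (auto simp: trm.map_id)
qed

lemma plab_transpose_invol: "plab (transpose a b) (plab (transpose a b) \<zeta>) = \<zeta>"
  by (cases \<zeta>) (auto simp: image_image)

text \<open>
  Only formulae with names from the history are compared: a name that is fresh for the configuration
  is then fresh for the formula too, so that it may be exchanged for another.
\<close>

definition logeq ::
  "('c, 'e, 'i) form set \<Rightarrow> ('c, 'n, 'e) lts \<Rightarrow> ('c, 'n, 'e) conf \<Rightarrow> ('c, 'n, 'e) conf \<Rightarrow> bool" where
  "logeq F step C D \<longleftrightarrow> cnames D = cnames C \<and>
     (\<forall>\<phi>\<in>F. fv \<phi> = {} \<and> fnames \<phi> \<subseteq> cnames C \<longrightarrow> (sat step C \<phi> \<longleftrightarrow> sat step D \<phi>))"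

lemma logeq_sym: "logeq F step C D \<Longrightarrow> logeq F step D C"
  unfolding logeq_def by auto

text \<open>Through \<open>index\<close> any set of configurations can index a conjunction, as
  separating formulae require. Closure under \<open>gmap\<close> allows a name to be abstracted into
  a variable.\<close>

locale hennessy_milner =
  fixes step :: "('c, 'n, 'e::infinite) lts" and F :: "('c, 'e, 'i) form set"
    and index :: "('c, 'n, 'e) conf \<Rightarrow> 'i"
  assumes inj_index: "inj index"
    and step_pconf: "inj \<pi> \<Longrightarrow> step C \<zeta> C' \<Longrightarrow> step (pconf \<pi> C) (plab \<pi> \<zeta>) (pconf \<pi> C')"
    and step_names: "step C \<zeta> C' \<Longrightarrow> cnames C' = lnames \<zeta> \<union> cnames C \<and> lnames \<zeta> \<inter> cnames C = {}"
    and FTau: "\<phi> \<in> F \<Longrightarrow> FTau \<phi> \<in> F"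
    and FAct: "\<phi> \<in> F \<Longrightarrow> FAct x a \<phi> \<in> F"
    and FNeg: "\<phi> \<in> F \<Longrightarrow> FNeg \<phi> \<in> F"
    and FConj: "(\<And>i \<phi>. G i = Some \<phi> \<Longrightarrow> \<phi> \<in> F) \<Longrightarrow> FConj G \<in> F"
    and gmap: "\<phi> \<in> F \<Longrightarrow> gmap g \<phi> \<in> F"
begin

section \<open>Equivariance of weak transitions and of satisfaction\<close>

lemma weak_pconf:
  assumes "inj \<pi>" "weak step C \<zeta> C'"
  shows "weak step (pconf \<pi> C) (plab \<pi> \<zeta>) (pconf \<pi> C')"
  using assms(2)
  by (rule weak_lift[where R="\<lambda>C \<zeta> C'. weak step (pconf \<pi> C) (plab \<pi> \<zeta>) (pconf \<pi> C')"])
    (auto intro: weak_tau_refl weak_step step_pconf[OF assms(1)] weak_tauL weak_tauR)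

lemma weak_names:
  assumes "weak step C \<zeta> C'"
  shows "cnames C' = lnames \<zeta> \<union> cnames C \<and> lnames \<zeta> \<inter> cnames C = {}"
  using assms
  by (rule weak_lift[where
    R="\<lambda>C \<zeta> C'. cnames C' = lnames \<zeta> \<union> cnames C \<and> lnames \<zeta> \<inter> cnames C = {}"])
    (auto dest: step_names)

lemma weak_transpose_ex:
  "(\<exists>C'. weak step (pconf (transpose a b) C) (plab (transpose a b) \<zeta>) C' \<and> Q C') \<longleftrightarrow>
   (\<exists>C'. weak step C \<zeta> C' \<and> Q (pconf (transpose a b) C'))"
proof
  assume "\<exists>C'. weak step (pconf (transpose a b) C) (plab (transpose a b) \<zeta>) C' \<and> Q C'"
  then obtain C' where C': "weak step (pconf (transpose a b) C) (plab (transpose a b) \<zeta>) C'" "Q C'"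
    by blast
  from weak_pconf[OF inj_transpose C'(1), of a b]
  have "weak step C \<zeta> (pconf (transpose a b) C')"
    by (simp only: pconf_transpose_invol plab_transpose_invol)
  with C'(2) show "\<exists>C'. weak step C \<zeta> C' \<and> Q (pconf (transpose a b) C')"
    by (metis pconf_transpose_invol)
qed (use weak_pconf[OF inj_transpose] in blast)

text \<open>In this form the quantifier of \<open>FAct\<close> is visibly invariant under bijections
  of the names.\<close>

lemma cofinite_iff: "(\<exists>N. finite (- N) \<and> (\<forall>l\<in>N. Q l)) \<longleftrightarrow> finite {l. \<not> Q l}"
proof
  assume "\<exists>N. finite (- N) \<and> (\<forall>l\<in>N. Q l)"
  then obtain N where "finite (- N)" "\<forall>l\<in>N. Q l" by blast
  moreover from this have "{l. \<not> Q l} \<subseteq> - N" by blast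
  ultimately show "finite {l. \<not> Q l}" by (blast intro: finite_subset)
next
  assume "finite {l. \<not> Q l}"
  then show "\<exists>N. finite (- N) \<and> (\<forall>l\<in>N. Q l)"
    by (intro exI[of _ "{l. Q l}"]) (simp add: Collect_neg_eq[symmetric])
qed

lemma sat_pconf:
  "sat step (pconf (transpose a b) C) (gmap (\<lambda>k. Nm (transpose a b k)) \<phi>) \<longleftrightarrow> sat step C \<phi>"
proof (induction \<phi> arbitrary: C rule: form_fsub_induct)
  case (Tau \<phi>)
  show ?case
    using weak_transpose_ex[of a b C XTau "\<lambda>C'. sat step C' (gmap (\<lambda>k. Nm (transpose a b k)) \<phi>)"] Tau by simp
next
  case (Act x c \<phi>)
  let ?\<pi> = "transpose a b"
  define A where "A l \<longleftrightarrow> (\<exists>C'. weak step (pconf ?\<pi> C) (XAct l c) C' \<and>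
    sat step C' (fsub (Suc x) l (gmap (\<lambda>k. Nm (?\<pi> k)) \<phi>)))" for l
  define B where "B l \<longleftrightarrow> (\<exists>C'. weak step C (XAct l c) C' \<and> sat step C' (fsub x l \<phi>))" for l
  have AB: "A (?\<pi> l) \<longleftrightarrow> B l" for l
    using weak_transpose_ex[of a b C "XAct l c" "\<lambda>C'. sat step C' (fsub (Suc x) (?\<pi> l) (gmap (\<lambda>k. Nm (?\<pi> k)) \<phi>))"]
      Act unfolding A_def B_def by (simp add: fsub_Suc_gmap)
  \<comment> \<open>The failing names on the two sides correspond under the transposition, so both
    sets are finite or neither is.\<close>
  then have "{l. \<not> A l} = ?\<pi> ` {l. \<not> B l}"
    by (auto simp: image_iff) (metis transpose_involutory)
  then have "finite {l. \<not> A l} \<longleftrightarrow> finite {l. \<not> B l}"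
    by (simp add: finite_image_iff inj_on_subset[OF inj_transpose])
  then show ?case by (simp add: cofinite_iff A_def B_def)
next
  case (Conj G)
  then show ?case by (simp add: map_option_case split: option.splits)
next
  case (Hasco v)
  then show ?case
    by (cases C; cases v) (auto simp: Hasco_phist inj_image_mem_iff)
next
  case (Eq v1 v2)
  have "(Extn (transpose a b k), Extn (transpose a b l)) \<in>
      map_prod (ptn (transpose a b)) (ptn (transpose a b)) ` E \<longleftrightarrow> (Extn k, Extn l) \<in> E"
    for k l and E :: "('n, 'e) trn rel"
    using mem_map_prod_image[OF inj_ptn[OF inj_transpose[of a b]], of "Extn k" "Extn l" E] by simp
  then show ?case
    by (cases C; cases v1; cases v2) (auto simp: Hasco_phist inj_image_mem_iff)
next
  case (Co K \<phi>)
  let ?\<pi> = "transpose a b"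
  have invol: "?\<pi> ` ?\<pi> ` L = L" for L by (simp add: image_image)
  have "inj (gval (\<lambda>k. Nm (?\<pi> k)))"
  proof (rule injI)
    fix v w assume "gval (\<lambda>k. Nm (?\<pi> k)) v = gval (\<lambda>k. Nm (?\<pi> k)) w"
    then show "v = w" by (cases v; cases w) (auto dest: injD[OF inj_transpose])
  qed
  moreover have "Nm ` L = gval (\<lambda>k. Nm (?\<pi> k)) ` Nm ` ?\<pi> ` L" for L by (simp add: image_image)
  ultimately have K: "gval (\<lambda>k. Nm (?\<pi> k)) ` K = Nm ` L \<longleftrightarrow> K = Nm ` ?\<pi> ` L" for L
    by (metis inj_image_eq_iff)
  have ex: "(\<exists>C'. weak step (pconf ?\<pi> C) (XCo L) C' \<and> sat step C' (gmap (\<lambda>k. Nm (?\<pi> k)) \<phi>)) \<longleftrightarrow>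
    (\<exists>C'. weak step C (XCo (?\<pi> ` L)) C' \<and> sat step C' \<phi>)" for L
    using weak_transpose_ex[of a b C "XCo (?\<pi> ` L)" "\<lambda>C'. sat step C' (gmap (\<lambda>k. Nm (?\<pi> k)) \<phi>)"] Co
    by (simp add: invol)
  have "sat step (pconf ?\<pi> C) (gmap (\<lambda>k. Nm (?\<pi> k)) (FCo K \<phi>)) \<longleftrightarrow>
    (\<exists>L. K = Nm ` ?\<pi> ` L \<and> (\<exists>C'. weak step (pconf ?\<pi> C) (XCo L) C' \<and> sat step C' (gmap (\<lambda>k. Nm (?\<pi> k)) \<phi>)))"
    by (simp add: K)
  also have "\<dots> \<longleftrightarrow> (\<exists>L. K = Nm ` ?\<pi> ` L \<and> (\<exists>C'. weak step C (XCo (?\<pi> ` L)) C' \<and> sat step C' \<phi>))"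
    unfolding ex ..
  also have "\<dots> \<longleftrightarrow> (\<exists>L. K = Nm ` L \<and> (\<exists>C'. weak step C (XCo L) C' \<and> sat step C' \<phi>))"
    by (metis invol)
  finally show ?case by simp
qed simp_all

text \<open>With equal recorded names \<open>logeq\<close> can only fail by a formula, which is
  negated if it holds on the wrong side. The conjunction of these formulae rejects all of
  \<open>S\<close> at once.\<close>

lemma distinguishing_formula:
  assumes "\<And>D. D \<in> S \<Longrightarrow> cnames D = cnames C \<and> \<not> logeq F step C D"
  obtains \<phi> where "\<phi> \<in> F" "fv \<phi> = {}" "fnames \<phi> \<subseteq> cnames C" "sat step C \<phi>"
    "\<And>D. D \<in> S \<Longrightarrow> \<not> sat step D \<phi>"
proof -
  have "\<exists>\<phi>\<in>F. fv \<phi> = {} \<and> fnames \<phi> \<subseteq> cnames C \<and> sat step C \<phi> \<and> \<not> sat step D \<phi>" if D: "D \<in> S" for D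
  proof -
    obtain \<phi> where \<phi>: "\<phi> \<in> F" "fv \<phi> = {}" "fnames \<phi> \<subseteq> cnames C" "sat step C \<phi> \<noteq> sat step D \<phi>"
      using assms[OF D] unfolding logeq_def by blast
    show ?thesis
    proof (cases "sat step C \<phi>")
      case True
      with \<phi> show ?thesis by blast
    next
      case False
      with \<phi> show ?thesis using FNeg by (intro bexI[of _ "FNeg \<phi>"]) auto
    qed
  qed
  then obtain f where f: "\<And>D. D \<in> S \<Longrightarrow> f D \<in> F \<and> fv (f D) = {} \<and> fnames (f D) \<subseteq> cnames C \<and>
      sat step C (f D) \<and> \<not> sat step D (f D)"
    by metis
  \<comment> \<open>The conjunct for \<open>D\<close> sits at \<open>index D\<close>, from which
    \<open>inv index\<close> recovers \<open>D\<close>; all other indices stay outside the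
    domain.\<close>
  define G where "G i = (if i \<in> index ` S then Some (f (inv index i)) else None)" for i
  have G: "G i = Some \<phi> \<longleftrightarrow> (\<exists>D\<in>S. i = index D \<and> \<phi> = f D)" for i \<phi>
    unfolding G_def using inj_index by auto
  show ?thesis
  proof
    show "FConj G \<in> F" using f by (intro FConj) (auto simp: G)
    show "fv (FConj G) = {}" using f by (auto simp: G elim!: option.set_cases)
    show "fnames (FConj G) \<subseteq> cnames C"
    proof
      fix k assume "k \<in> fnames (FConj G)"
      then obtain D where "D \<in> S" "k \<in> fnames (f D)" by (auto simp: G elim!: option.set_cases)
      then show "k \<in> cnames C" using f by blast
    qed
    show "sat step C (FConj G)" using f by (auto simp: G)
    show "\<not> sat step D (FConj G)" if "D \<in> S" for D
      using f[OF that] that unfolding sat.simps G by blast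
  qed
qed

section \<open>Matching transitions of logically equivalent configurations\<close>

lemma match_tau:
  assumes "logeq F step C D" "weak step C XTau C'"
  shows "\<exists>D'. weak step D XTau D' \<and> logeq F step C' D'"
proof (rule ccontr)
  assume no: "\<not> ?thesis"
  have "cnames C' = cnames C" using weak_names[OF assms(2)] by simp
  have CD: "cnames D = cnames C" using assms(1) by (simp add: logeq_def)
  obtain \<phi> where \<phi>: "\<phi> \<in> F" "fv \<phi> = {}" "fnames \<phi> \<subseteq> cnames C'" "sat step C' \<phi>"
    "\<And>D'. weak step D XTau D' \<Longrightarrow> \<not> sat step D' \<phi>"
    using distinguishing_formula[of "{D'. weak step D XTau D'}" C'] no weak_names CD \<open>cnames C' = cnames C\<close>
    by (smt (verit) Un_empty_left lnames.simps(1) mem_Collect_eq)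
  have "sat step C (FTau \<phi>)" using \<phi>(4) assms(2) by auto
  moreover have "\<not> sat step D (FTau \<phi>)" using \<phi>(5) by auto
  moreover have "FTau \<phi> \<in> F" using FTau \<phi>(1) by blast
  moreover have "fv (FTau \<phi>) = {}" "fnames (FTau \<phi>) \<subseteq> cnames C"
    using \<phi>(2,3) \<open>cnames C' = cnames C\<close> by simp_all
  ultimately show False using assms(1) unfolding logeq_def by blast
qed

text \<open>The separating formula mentions all names of \<open>K\<close>; they must be recorded for
  \<open>logeq\<close> to compare it.\<close>

lemma match_co:
  assumes "\<And>K \<phi>. K \<noteq> {} \<Longrightarrow> \<phi> \<in> F \<Longrightarrow> FCo K \<phi> \<in> F"
    and "logeq F step C D" "weak step C (XCo K) C'" "K \<noteq> {}" "K \<subseteq> cnames C"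
  shows "\<exists>D'. weak step D (XCo K) D' \<and> logeq F step C' D'"
proof (rule ccontr)
  assume no: "\<not> ?thesis"
  have "cnames C' = cnames C" using weak_names[OF assms(3)] by simp
  have CD: "cnames D = cnames C" using assms(2) by (simp add: logeq_def)
  obtain \<phi> where \<phi>: "\<phi> \<in> F" "fv \<phi> = {}" "fnames \<phi> \<subseteq> cnames C'" "sat step C' \<phi>"
    "\<And>D'. weak step D (XCo K) D' \<Longrightarrow> \<not> sat step D' \<phi>"
    using distinguishing_formula[of "{D'. weak step D (XCo K) D'}" C'] no weak_names CD \<open>cnames C' = cnames C\<close>
    by (smt (verit) Un_empty_left lnames.simps(3) mem_Collect_eq)
  have "sat step C (FCo (Nm ` K) \<phi>)" using \<phi>(4) assms(3) by auto
  moreover have "\<not> sat step D (FCo (Nm ` K) \<phi>)"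
    using \<phi>(5) by (auto simp: inj_image_eq_iff inj_def)
  moreover have "FCo (Nm ` K) \<phi> \<in> F" using assms(1,4) \<phi>(1) by simp
  moreover have "fv (FCo (Nm ` K) \<phi>) = {}" "fnames (FCo (Nm ` K) \<phi>) \<subseteq> cnames C"
    using \<phi>(2,3) assms(5) \<open>cnames C' = cnames C\<close> by auto
  ultimately show False
    using assms(2) unfolding logeq_def by blast
qed

lemma weak_act_rename:
  assumes "sane C" "weak step C (XAct l a) C'" "l' \<notin> cnames C"
  shows "weak step C (XAct l' a) (pconf (transpose l l') C')"
proof -
  have "l \<notin> cnames C" using weak_names[OF assms(2)] by simp
  then have "pconf (transpose l l') C = C"
    by (rule pconf_transpose_fresh[OF sane_xconf[OF assms(1)] _ assms(3)])
  then show ?thesis using weak_pconf[OF inj_transpose assms(2), of l l'] by simp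
qed

text \<open>A separating formula may mention the unrecorded \<open>l\<close>, while
  \<open>logeq\<close> compares formulae over recorded names and \<open>FAct\<close> speaks of
  almost all names. Abstracting \<open>l\<close> meets both: \<open>C\<close> satisfies the modality
  since any unrecorded \<open>l'\<close> can be exchanged for \<open>l\<close>, and a fresh instance
  in \<open>D\<close> can be exchanged back.\<close>

lemma match_act:
  assumes "logeq F step C D" "sane C" "sane D" "weak step C (XAct l a) C'"
  shows "\<exists>D'. weak step D (XAct l a) D' \<and> logeq F step C' D'"
proof (rule ccontr)
  assume no: "\<not> ?thesis"
  have C': "cnames C' = insert l (cnames C)" "l \<notin> cnames C" using weak_names[OF assms(4)] by simp_all
  have CD: "cnames D = cnames C" using assms(1) by (simp add: logeq_def)
  obtain \<phi> where \<phi>: "\<phi> \<in> F" "fv \<phi> = {}" "fnames \<phi> \<subseteq> insert l (cnames C)" "sat step C' \<phi>"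
    "\<And>D'. weak step D (XAct l a) D' \<Longrightarrow> \<not> sat step D' \<phi>"
    using distinguishing_formula[of "{D'. weak step D (XAct l a) D'}" C'] no weak_names CD C'
    by (smt (verit) insert_is_Un lnames.simps(2) mem_Collect_eq)
  define \<psi> where "\<psi> = gmap (Nm(l := Vr 0)) \<phi>"
  \<comment> \<open>Each name of \<open>\<phi>\<close> is \<open>l\<close> or recorded, and
    \<open>l'\<close> is not recorded, so putting \<open>l'\<close> for \<open>l\<close> agrees with
    the exchange of the two.\<close>
  have fsub: "fsub 0 l' \<psi> = gmap (\<lambda>k. Nm (transpose l l' k)) \<phi>" if "l' \<notin> cnames C" for l'
    unfolding \<psi>_def fsub_0_gmap
    by (rule gmap_cong) (use \<phi>(3) that in \<open>auto simp: vsub_def transpose_def\<close>)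
  have "fv (FAct 0 a \<psi>) = {}" "fnames (FAct 0 a \<psi>) \<subseteq> cnames C"
    using fv_gmap[of "Nm(l := Vr 0)" \<phi>] fnames_gmap[of "Nm(l := Vr 0)" \<phi>] \<phi>(2,3)
    unfolding \<psi>_def by (auto split: if_splits)
  moreover have "FAct 0 a \<psi> \<in> F" unfolding \<psi>_def using \<phi>(1) FAct gmap by blast
  ultimately have "sat step C (FAct 0 a \<psi>) \<longleftrightarrow> sat step D (FAct 0 a \<psi>)"
    using assms(1) unfolding logeq_def by blast
  moreover have fin: "finite (cnames C)"
  proof -
    have "finite (dom (fst (snd C)))" using assms(2) by (cases C) (simp add: sane.simps xconf.simps)
    then show ?thesis unfolding Htrn_def by (simp add: finite_ran)
  qed
  have "sat step C (FAct 0 a \<psi>)"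
  proof -
    have "weak step C (XAct l' a) (pconf (transpose l l') C') \<and>
        sat step (pconf (transpose l l') C') (fsub 0 l' \<psi>)" if "l' \<in> - cnames C" for l'
      using weak_act_rename[OF assms(2,4)] that \<phi>(4) by (simp add: fsub sat_pconf)
    then show ?thesis using fin by (auto intro!: exI[of _ "- cnames C"])
  qed
  ultimately obtain N where N: "finite (- N)"
    "\<And>l'. l' \<in> N \<Longrightarrow> \<exists>D'. weak step D (XAct l' a) D' \<and> sat step D' (fsub 0 l' \<psi>)"
    by auto
  \<comment> \<open>The witness must lie in \<open>N\<close> and be unrecorded, so that its exchange
    with \<open>l\<close> fixes \<open>D\<close>.\<close>
  have "finite (- N \<union> cnames C)" using N(1) fin by simp
  then obtain l' where l': "l' \<in> N" "l' \<notin> cnames C"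
    using ex_new_if_finite[OF infinite_UNIV] by blast
  from N(2)[OF l'(1)] obtain D' where D': "weak step D (XAct l' a) D'" "sat step D' (fsub 0 l' \<psi>)"
    by blast
  have "weak step D (XAct l a) (pconf (transpose l' l) D')"
    using weak_act_rename[OF assms(3) D'(1)] C'(2) CD by simp
  moreover have "sat step (pconf (transpose l' l) D') \<phi>"
    using D'(2) sat_pconf[of l l' "pconf (transpose l l') D'" \<phi>]
    by (simp add: fsub[OF l'(2)] pconf_transpose_invol transpose_commute[of l' l])
  ultimately show False using \<phi>(5) by blast
qed

end

section \<open>The three bisimulations\<close>

abbreviation cHasco :: "('c, 'n, 'e) conf \<Rightarrow> 'e set" where
  "cHasco C \<equiv> Hasco (fst (snd C))"

section \<open>Extended against commit-sensitive transitions\<close>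

lemma core_step_names:
  assumes "core_step C \<zeta> C'"
  shows "cnames C' = lnames \<zeta> \<union> cnames C \<and> lnames \<zeta> \<inter> cnames C = {}"
  using assms by cases (auto simp: Htrn_upd Htrn_hupd fresh_names_def)

lemma ext_step_names:
  assumes "ext_step C \<zeta> C'"
  shows "cnames C' = lnames \<zeta> \<union> cnames C \<and> lnames \<zeta> \<inter> cnames C = {}"
proof -
  have "ext_rule C \<zeta> C'" using assms by (simp add: ext_step_def)
  then show ?thesis by cases (auto simp: Htrn_hupd dest: core_step_names)
qed

lemma cs_step_names:
  assumes "cs_step C \<zeta> C'"
  shows "cnames C' = lnames \<zeta> \<union> cnames C \<and> lnames \<zeta> \<inter> cnames C = {}"
proof -
  have "cs_rule C \<zeta> C'" using assms by (simp add: cs_step_def)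
  then show ?thesis by cases (auto simp: Htrn_hupd dest: core_step_names)
qed

lemma core_step_sane:
  assumes "core_step C \<zeta> C'" "sane C" "xconf C'"
  shows "sane C' \<and> fst C \<subseteq> fst C' \<and> cHasco C' = cHasco C \<and> co_eq C' = co_eq C"
proof -
  obtain E H P where "C = (E, H, P)" by (cases C)
  then show ?thesis using core_step_facts[of E H P \<zeta> C'] assms by simp
qed

lemma core_step_not_XCo: "\<not> core_step C (XCo K) C'"
  by (auto elim: core_step.cases)

text \<open>Committed names are recorded, and recorded names are related to themselves. Agreement on
  \<open>co_eq\<close> therefore includes agreement on \<open>Hasco\<close>, which is how
  \<open>FEq\<close> subsumes \<open>FHasco\<close>.\<close>

lemma Hasco_iff_co_eq:
  assumes "sane C"
  shows "k \<in> cHasco C \<longleftrightarrow> (k, k) \<in> co_eq C"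
proof -
  obtain E H P where C: "C = (E, H, P)" by (cases C)
  have "k \<in> Hasco H \<Longrightarrow> (Extn k, Extn k) \<in> E"
    using sane_Extn[OF assms[unfolded C]] Hasco_subset_settled[of H] settled_subset_Htrn[of H] by blast
  then show ?thesis unfolding C by auto
qed

lemma sane_class_Hasco:
  assumes "sane C" "(Extn k, Extn k') \<in> fst C"
  shows "k \<in> cHasco C \<longleftrightarrow> k' \<in> cHasco C"
proof -
  obtain E H P where "C = (E, H, P)" by (cases C)
  then show ?thesis using sane_Hasco[of E H P k k'] assms by simp
qed

text \<open>A commit labelled \<open>XTau\<close> counts as empty, rightly: its class has no
  external name.\<close>

primrec committed :: "('c, 'e) xlab \<Rightarrow> 'e set" where
  "committed XTau = {}"
| "committed (XAct k a) = {}"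
| "committed (XCo K) = K"

primrec hide_co :: "('c, 'e) xlab \<Rightarrow> ('c, 'e) xlab" where
  "hide_co XTau = XTau"
| "hide_co (XAct k a) = XAct k a"
| "hide_co (XCo K) = XTau"

text \<open>The label determines the growth of \<open>Hasco\<close> and \<open>co_eq\<close>, as a
  commit contributes all external names of one class. Hence both stay equal along steps with equal
  labels, without appeal to formulae.\<close>

lemma cs_step_facts:
  assumes "cs_step C \<zeta> C'" "sane C"
  shows "sane C'" "fst C \<subseteq> fst C'" "cHasco C' = cHasco C \<union> committed \<zeta>"
    "co_eq C' = co_eq C \<union> committed \<zeta> \<times> committed \<zeta>" "ext_step C (hide_co \<zeta>) C'"
    "\<zeta> = XCo K \<Longrightarrow> K \<noteq> {} \<and> cHasco C \<inter> K = {} \<and> K \<subseteq> cnames C \<and>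
      (\<forall>k\<in>K. \<forall>k'\<in>K. (Extn k, Extn k') \<in> fst C)"
proof -
  have x: "cs_rule C \<zeta> C'" "xconf C" "xconf C'" using assms(1) by (auto simp: cs_step_def)
  from x(1) have "sane C' \<and> fst C \<subseteq> fst C' \<and> cHasco C' = cHasco C \<union> committed \<zeta> \<and>
    co_eq C' = co_eq C \<union> committed \<zeta> \<times> committed \<zeta> \<and> ext_rule C (hide_co \<zeta>) C' \<and>
    (\<forall>K. \<zeta> = XCo K \<longrightarrow> K \<noteq> {} \<and> cHasco C \<inter> K = {} \<and> K \<subseteq> cnames C \<and>
      (\<forall>k\<in>K. \<forall>k'\<in>K. (Extn k, Extn k') \<in> fst C))"
  proof cases
    case core
    have "\<zeta> \<noteq> XCo K" for K using core core_step_not_XCo[of C K C'] by blast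
    moreover from this have "committed \<zeta> = {}" "hide_co \<zeta> = \<zeta>"
      by (cases \<zeta>; simp)+
    ultimately show ?thesis using core_step_sane[OF core assms(2) x(3)] ext_rule.core[OF core] by simp
  next
    case (commit_ext P k Q E H)
    note C = commit_ext(1-3)
    note co = commit_facts[OF assms(2)[unfolded C] commit_ext(4) x(3)[unfolded C]]
    have "Eext E k \<subseteq> Htrn H"
      using co(5) sane_Extn[OF assms(2)[unfolded C]] by blast
    then show ?thesis
      using co ext_rule.commit[OF commit_ext(4)] commit_ext(5) unfolding C by (simp del: co_eq.simps)
  next
    case (commit_int P k Q E H)
    note C = commit_int(1-3)
    note co = commit_facts[OF assms(2)[unfolded C] commit_int(4) x(3)[unfolded C]]
    then show ?thesis
      using ext_rule.commit[OF commit_int(4)] commit_int(5) unfolding C by (simp del: co_eq.simps)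
  qed
  with x(2,3) show "sane C'" "fst C \<subseteq> fst C'" "cHasco C' = cHasco C \<union> committed \<zeta>"
    "co_eq C' = co_eq C \<union> committed \<zeta> \<times> committed \<zeta>" "ext_step C (hide_co \<zeta>) C'"
    "\<zeta> = XCo K \<Longrightarrow> K \<noteq> {} \<and> cHasco C \<inter> K = {} \<and> K \<subseteq> cnames C \<and>
      (\<forall>k\<in>K. \<forall>k'\<in>K. (Extn k, Extn k') \<in> fst C)"
    unfolding ext_step_def by blast+
qed

lemma ext_step_cases:
  assumes "ext_step C \<zeta> C'"
  obtains "cs_step C \<zeta> C'" "\<And>K. \<zeta> \<noteq> XCo K" | K where "\<zeta> = XTau" "cs_step C (XCo K) C'"
proof -
  have x: "ext_rule C \<zeta> C'" "xconf C" "xconf C'" using assms by (auto simp: ext_step_def)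
  from x(1) show ?thesis
  proof cases
    case core
    then show ?thesis using that(1) x(2,3) core_step_not_XCo
      by (metis cs_rule.core cs_step_def)
  next
    case (commit P k Q E H)
    show ?thesis
    proof (cases "Eext E k = {}")
      case True
      then have "cs_step C \<zeta> C'"
        using cs_rule.commit_int[OF commit(4) True] x(2,3) unfolding commit(1-3) cs_step_def by blast
      then show ?thesis using that(1) commit(2) by blast
    next
      case False
      then have "cs_step C (XCo (Eext E k)) C'"
        using cs_rule.commit_ext[OF commit(4) False] x(2,3) unfolding commit(1-3) cs_step_def by blast
      then show ?thesis using that(2) commit(2) by blast
    qed
  qed
qed

lemma cs_step_sane: "cs_step C \<zeta> C' \<Longrightarrow> sane C \<Longrightarrow> sane C'"
  by (rule cs_step_facts)

lemma ext_step_sane: "ext_step C \<zeta> C' \<Longrightarrow> sane C \<Longrightarrow> sane C'"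
  by (erule ext_step_cases) (blast intro: cs_step_sane)+

lemma weak_cs_facts:
  assumes "weak cs_step C \<zeta> C'" "sane C"
  shows "sane C'" "fst C \<subseteq> fst C'" "cHasco C' = cHasco C \<union> committed \<zeta>"
    "co_eq C' = co_eq C \<union> committed \<zeta> \<times> committed \<zeta>" "weak ext_step C (hide_co \<zeta>) C'"
proof -
  from assms(1) have "sane C \<longrightarrow> sane C' \<and> fst C \<subseteq> fst C' \<and> cHasco C' = cHasco C \<union> committed \<zeta> \<and>
    co_eq C' = co_eq C \<union> committed \<zeta> \<times> committed \<zeta> \<and> weak ext_step C (hide_co \<zeta>) C'"
  proof (rule weak_lift[where R="\<lambda>C \<zeta> C'. sane C \<longrightarrow> sane C' \<and> fst C \<subseteq> fst C' \<and>
      cHasco C' = cHasco C \<union> committed \<zeta> \<and>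
      co_eq C' = co_eq C \<union> committed \<zeta> \<times> committed \<zeta> \<and> weak ext_step C (hide_co \<zeta>) C'"], goal_cases)
    case (1 D)
    then show ?case by (simp add: weak_tau_refl)
  next
    case (2 D \<zeta> D')
    show ?case
      by (intro impI) (simp add: cs_step_facts(1-4)[OF 2] weak_step[of ext_step, OF cs_step_facts(5)[OF 2]])
  next
    case (3 D \<zeta> D' D'')
    then show ?case using weak_tauR[of ext_step D "hide_co \<zeta>" D' D''] by auto
  next
    case (4 D \<zeta> D' D'')
    then show ?case using weak_tauL[of ext_step D D' "hide_co \<zeta>" D''] by auto
  qed
  with assms(2) show "sane C'" "fst C \<subseteq> fst C'" "cHasco C' = cHasco C \<union> committed \<zeta>"
    "co_eq C' = co_eq C \<union> committed \<zeta> \<times> committed \<zeta>" "weak ext_step C (hide_co \<zeta>) C'"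
    by blast+
qed

text \<open>An external commit adds a non-empty set of names not committed before, and
  \<open>Hasco\<close> never shrinks. If it ends unchanged, no such commit occurred and every step
  keeps its label in the commit-sensitive system.\<close>

lemma weak_ext_facts:
  assumes "weak ext_step C \<zeta> C'" "sane C"
  shows "sane C'" "fst C \<subseteq> fst C'" "cHasco C \<subseteq> cHasco C'"
    "cHasco C' = cHasco C \<Longrightarrow> weak cs_step C \<zeta> C'"
proof -
  from assms(1) have "sane C \<longrightarrow> sane C' \<and> fst C \<subseteq> fst C' \<and> cHasco C \<subseteq> cHasco C' \<and>
    (cHasco C' = cHasco C \<longrightarrow> weak cs_step C \<zeta> C')"
  proof (rule weak_lift[where R="\<lambda>C \<zeta> C'. sane C \<longrightarrow> sane C' \<and> fst C \<subseteq> fst C' \<and>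
      cHasco C \<subseteq> cHasco C' \<and> (cHasco C' = cHasco C \<longrightarrow> weak cs_step C \<zeta> C')"], goal_cases)
    case (1 D)
    then show ?case by (simp add: weak_tau_refl)
  next
    case (2 D \<zeta> D')
    then show ?case
    proof (cases rule: ext_step_cases)
      case 1
      show ?thesis
        by (intro impI) (simp add: cs_step_facts(1-3)[OF 1(1)] weak_step[of cs_step, OF 1(1)])
    next
      case (2 K)
      show ?thesis
      proof (intro impI)
        assume D: "sane D"
        have "cHasco D' = cHasco D \<union> K" "K \<noteq> {}" "cHasco D \<inter> K = {}"
          using cs_step_facts(3)[OF 2(2) D] cs_step_facts(6)[OF 2(2) D HOL.refl] by simp_all
        then have "cHasco D \<subseteq> cHasco D'" "cHasco D' \<noteq> cHasco D" by blast+
        then show "sane D' \<and> fst D \<subseteq> fst D' \<and> cHasco D \<subseteq> cHasco D' \<and>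
          (cHasco D' = cHasco D \<longrightarrow> weak cs_step D \<zeta> D')"
          using cs_step_facts(1,2)[OF 2(2) D] by simp
      qed
    qed
  next
    case (3 D \<zeta> D' D'')
    then show ?case using weak_tauR[of cs_step D \<zeta> D' D''] by auto
  next
    case (4 D \<zeta> D' D'')
    then show ?case using weak_tauL[of cs_step D D' \<zeta> D''] by auto
  qed
  with assms(2) show "sane C'" "fst C \<subseteq> fst C'" "cHasco C \<subseteq> cHasco C'"
    "cHasco C' = cHasco C \<Longrightarrow> weak cs_step C \<zeta> C'"
    by blast+
qed

text \<open>Growth of \<open>Hasco\<close> forces an external commit; all that precedes the earliest
  one is silent in the commit-sensitive system too.\<close>

lemma first_commit:
  assumes "weak ext_step C XTau C'" "sane C" "cHasco C' \<noteq> cHasco C"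
  obtains D K D' where "weak cs_step C XTau D" "cs_step D (XCo K) D'" "weak ext_step D' XTau C'"
proof -
  have "(\<lambda>D D'. ext_step D XTau D')\<^sup>*\<^sup>* C C'" using assms(1) by (simp add: weak_def)
  then have "\<exists>D K D'. weak cs_step C XTau D \<and> cs_step D (XCo K) D' \<and> weak ext_step D' XTau C'"
    using assms(2,3)
  proof (induction rule: converse_rtranclp_induct)
    case (step C1 C2)
    from step.hyps(1) show ?case
    proof (cases rule: ext_step_cases)
      case 1
      have "sane C2" "cHasco C2 = cHasco C1" using cs_step_facts(1,3)[OF 1(1) step.prems(1)] by auto
      with step.IH step.prems(2)
      have "\<exists>D K D'. weak cs_step C2 XTau D \<and> cs_step D (XCo K) D' \<and> weak ext_step D' XTau C'"
        by simp
      then obtain D K D' where "weak cs_step C2 XTau D" "cs_step D (XCo K) D'" "weak ext_step D' XTau C'"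
        by blast
      moreover from this(1) have "weak cs_step C1 XTau D"
        by (rule weak_tauL[OF weak_step[of cs_step, OF 1(1)]])
      ultimately show ?thesis by blast
    next
      case (2 K)
      have "weak ext_step C2 XTau C'" using step.hyps(2) by (simp add: weak_def)
      with 2(2) show ?thesis using weak_tau_refl by blast
    qed
  qed simp
  then show ?thesis using that by blast
qed

lemma simulation_weak:
  assumes "\<And>C D \<zeta> C'. R C D \<Longrightarrow> step C \<zeta> C' \<Longrightarrow> \<exists>D'. weak step D \<zeta> D' \<and> R C' D'"
    and "R C D" "weak step C \<zeta> C'"
  shows "\<exists>D'. weak step D \<zeta> D' \<and> R C' D'"
proof -
  from assms(3) have "\<forall>D. R C D \<longrightarrow> (\<exists>D'. weak step D \<zeta> D' \<and> R C' D')"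
  proof (rule weak_lift[where R="\<lambda>C \<zeta> C'. \<forall>D. R C D \<longrightarrow> (\<exists>D'. weak step D \<zeta> D' \<and> R C' D')"], goal_cases)
    case 1
    then show ?case using weak_tau_refl by blast
  next
    case 2
    then show ?case using assms(1) by blast
  next
    case 3
    then show ?case using weak_tauR by meson
  next
    case 4
    then show ?case using weak_tauL by meson
  qed
  with assms(2) show ?thesis by blast
qed

text \<open>One induction over the common language serves all three fragments: matching weak steps
  handle the modalities, and agreement on \<open>co_eq\<close> settles both kinds of atoms.\<close>

lemma bisimulation_sat:
  assumes sim: "\<And>C D \<zeta> C'. R C D \<Longrightarrow> step C \<zeta> C' \<Longrightarrow> \<exists>D'. weak step D \<zeta> D' \<and> R C' D'"
    and sym: "\<And>C D. R C D \<Longrightarrow> R D C"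
    and co_eq: "\<And>C D. R C D \<Longrightarrow> sane C \<and> co_eq C = co_eq D"
    and "R C D"
  shows "sat step C \<phi> \<longleftrightarrow> sat step D \<phi>"
proof -
  have wsim: "\<exists>D'. weak step D \<zeta> D' \<and> R C' D'" if "R C D" "weak step C \<zeta> C'" for C D \<zeta> C'
    by (rule simulation_weak[of R step C D \<zeta> C']) (use sim that in blast)+
  have imp: "\<exists>D'. weak step D \<zeta> D' \<and> Q D'"
    if "R C D" "\<And>C D. R C D \<Longrightarrow> Q C \<longleftrightarrow> Q D" "\<exists>C'. weak step C \<zeta> C' \<and> Q C'" for C D \<zeta> Q
    using that(3) wsim[OF that(1)] that(2) by blast
  have ex: "(\<exists>C'. weak step C \<zeta> C' \<and> Q C') \<longleftrightarrow> (\<exists>D'. weak step D \<zeta> D' \<and> Q D')"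
    if "R C D" "\<And>C D. R C D \<Longrightarrow> Q C \<longleftrightarrow> Q D" for C D \<zeta> Q
    using imp[of C D Q \<zeta>] imp[of D C Q \<zeta>] that sym[OF that(1)] by blast
  show ?thesis
    using \<open>R C D\<close>
  proof (induction \<phi> arbitrary: C D rule: form_fsub_induct)
    case (Tau \<phi>)
    show ?case unfolding sat.simps by (rule ex[OF Tau.prems Tau.IH])
  next
    case (Act x a \<phi>)
    have "(\<exists>C'. weak step C (XAct l a) C' \<and> sat step C' (fsub x l \<phi>)) \<longleftrightarrow>
      (\<exists>D'. weak step D (XAct l a) D' \<and> sat step D' (fsub x l \<phi>))" for l
      by (rule ex[OF Act.prems Act.IH])
    then show ?case by simp
  next
    case (Conj G)
    then show ?case unfolding sat.simps by metis
  next
    case (Hasco v)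
    have "k \<in> cHasco C \<longleftrightarrow> k \<in> cHasco D" for k
      using co_eq[OF Hasco] co_eq[OF sym[OF Hasco]] Hasco_iff_co_eq by metis
    then show ?case by simp
  next
    case (Eq v1 v2)
    have "sat step C (FEq v1 v2) \<longleftrightarrow> (\<exists>k k'. v1 = Nm k \<and> v2 = Nm k' \<and> (k, k') \<in> co_eq C)" for C
      by (cases C) simp
    then show ?case using co_eq[OF Eq] by simp
  next
    case (Co K \<phi>)
    have "(\<exists>C'. weak step C (XCo L) C' \<and> sat step C' \<phi>) \<longleftrightarrow>
      (\<exists>D'. weak step D (XCo L) D' \<and> sat step D' \<phi>)" for L
      by (rule ex[OF Co.prems Co.IH])
    then show ?case by simp
  qed simp
qed

section \<open>The logical equivalences as bisimulations\<close>

lemma gmap_form_Hasco: "\<phi> \<in> form_Hasco \<Longrightarrow> gmap g \<phi> \<in> form_Hasco"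
  by (induction rule: form_Hasco.induct) (auto intro!: form_Hasco.intros)

lemma gmap_form_Eq: "\<phi> \<in> form_Eq \<Longrightarrow> gmap g \<phi> \<in> form_Eq"
  by (induction rule: form_Eq.induct) (auto intro!: form_Eq.intros)

lemma gmap_form_Canco: "\<phi> \<in> form_Canco \<Longrightarrow> gmap g \<phi> \<in> form_Canco"
  by (induction rule: form_Canco.induct) (auto intro!: form_Canco.intros)

context
  fixes index :: "('c, 'n, 'e::infinite) conf \<Rightarrow> 'i"
  assumes index: "inj index"
begin

interpretation Hasco: hennessy_milner "ext_step :: ('c, 'n, 'e) lts" form_Hasco index
  by unfold_locales (auto intro: index ext_step_pconf form_Hasco.intros gmap_form_Hasco
    dest: ext_step_names)

interpretation Eq: hennessy_milner "ext_step :: ('c, 'n, 'e) lts" form_Eq index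
  by unfold_locales (auto intro: index ext_step_pconf form_Eq.intros gmap_form_Eq
    dest: ext_step_names)

interpretation Canco: hennessy_milner "cs_step :: ('c, 'n, 'e) lts" form_Canco index
  by unfold_locales (auto intro: index cs_step_pconf form_Canco.intros gmap_form_Canco
    dest: cs_step_names)

text \<open>Only recorded names are tested by \<open>logeq\<close>; this suffices because committed
  names are recorded.\<close>

lemma logeq_Hasco_cHasco:
  assumes "logeq (form_Hasco :: ('c, 'e, 'i) form set) (ext_step :: ('c, 'n, 'e) lts) C D"
  shows "cHasco C = cHasco D"
proof -
  have "k \<in> cHasco C \<longleftrightarrow> k \<in> cHasco D" if "k \<in> cnames C" for k
  proof -
    have "FHasco (Nm k) \<in> (form_Hasco :: ('c, 'e, 'i) form set)" by (rule form_Hasco.intros)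
    moreover have "fv (FHasco (Nm k) :: ('c, 'e, 'i) form) = {}"
      "fnames (FHasco (Nm k) :: ('c, 'e, 'i) form) \<subseteq> cnames C" using that by auto
    ultimately have "sat ext_step C (FHasco (Nm k) :: ('c, 'e, 'i) form) \<longleftrightarrow>
        sat ext_step D (FHasco (Nm k) :: ('c, 'e, 'i) form)"
      using assms unfolding logeq_def by blast
    then show ?thesis by simp
  qed
  moreover have "cHasco C \<subseteq> cnames C" "cHasco D \<subseteq> cnames C"
    using Hasco_subset_settled settled_subset_Htrn assms unfolding logeq_def by (metis subset_trans)+
  ultimately show ?thesis by blast
qed

text \<open>
  The converse simulation could commit \<open>K\<close> in several steps. But then the first configuration would
  have to match the first of them, whereas \<open>K\<close> lies within one of its classes and classes only grow:
  it can only commit \<open>K\<close> as a whole.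
\<close>

lemma logeq_Hasco_sim:
  assumes R: "sane C" "sane D" "logeq (form_Hasco :: ('c, 'e, 'i) form set) (ext_step :: ('c, 'n, 'e) lts) C D"
    "co_eq C = co_eq D" and C': "cs_step C \<zeta> C'"
  shows "\<exists>D'. weak cs_step D \<zeta> D' \<and> sane C' \<and> sane D' \<and>
    logeq (form_Hasco :: ('c, 'e, 'i) form set) ext_step C' D' \<and> co_eq C' = co_eq D'"
proof -
  note CC' = cs_step_facts[OF C' R(1)]
  have H: "cHasco C = cHasco D" using logeq_Hasco_cHasco[OF R(3)] .
  have "\<exists>D'. weak cs_step D \<zeta> D' \<and> logeq (form_Hasco :: ('c, 'e, 'i) form set) ext_step C' D'"
  proof (cases "\<exists>K. \<zeta> = XCo K")
    case False
    then have \<zeta>: "hide_co \<zeta> = \<zeta>" "committed \<zeta> = {}" by (cases \<zeta>; simp)+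
    have "\<exists>D'. weak ext_step D \<zeta> D' \<and> logeq (form_Hasco :: ('c, 'e, 'i) form set) ext_step C' D'"
      using False Hasco.match_tau[OF R(3)] Hasco.match_act[OF R(3,1,2)] weak_step[of ext_step, OF CC'(5)]
      by (cases \<zeta>) auto
    then obtain D' where D': "weak ext_step D \<zeta> D'"
      "logeq (form_Hasco :: ('c, 'e, 'i) form set) ext_step C' D'" by blast
    \<comment> \<open>Equivalence ties \<open>Hasco\<close> at \<open>D'\<close> to that at
      \<open>C'\<close>, which did not grow, so the match hides no external commit.\<close>
    have "cHasco D' = cHasco D" using logeq_Hasco_cHasco[OF D'(2)] CC'(3) H \<zeta> by simp
    then show ?thesis using weak_ext_facts(4)[OF D'(1) R(2)] D'(2) by blast
  next
    case True
    then obtain K where \<zeta>: "\<zeta> = XCo K" by blast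
    have K: "K \<noteq> {}" "cHasco C \<inter> K = {}" "\<And>k k'. k \<in> K \<Longrightarrow> k' \<in> K \<Longrightarrow> (Extn k, Extn k') \<in> fst C"
      using CC'(6)[OF \<zeta>] by blast+
    have "weak ext_step C XTau C'" using weak_step[of ext_step, OF CC'(5)] \<zeta> by simp
    from Hasco.match_tau[OF R(3) this] obtain D' where D': "weak ext_step D XTau D'"
      "logeq (form_Hasco :: ('c, 'e, 'i) form set) ext_step C' D'" by blast
    have HD': "cHasco D' = cHasco D \<union> K" using logeq_Hasco_cHasco[OF D'(2)] CC'(3) H \<zeta> by simp
    with K(1,2) H have "cHasco D' \<noteq> cHasco D" by blast
    from first_commit[OF D'(1) R(2) this] obtain D1 K1 D2 where
      D1: "weak cs_step D XTau D1" "cs_step D1 (XCo K1) D2" "weak ext_step D2 XTau D'" .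
    note DD1 = weak_cs_facts[OF D1(1) R(2)]
    note D12 = cs_step_facts[OF D1(2) DD1(1)]
    have HD2: "cHasco D2 = cHasco D \<union> K1" using D12(3) DD1(3) by simp
    have K1: "K1 \<noteq> {}" "cHasco D \<inter> K1 = {}" using D12(6)[OF HOL.refl] DD1(3) by auto
    \<comment> \<open>Names committed at \<open>D2\<close> remain so at \<open>D'\<close>, where
      only \<open>K\<close> is new.\<close>
    have "K1 \<subseteq> K" using weak_ext_facts(3)[OF D1(3) D12(1)] HD2 HD' K1(2) by blast
    moreover have "K \<subseteq> K1"
    proof
      fix k assume k: "k \<in> K"
      have "weak ext_step D XTau D2"
        using DD1(5) weak_step[of ext_step, OF D12(5)] weak_tauL[of ext_step] by simp
      from Hasco.match_tau[OF logeq_sym[OF R(3)] this] obtain C2 where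
        C2: "weak ext_step C XTau C2" "logeq (form_Hasco :: ('c, 'e, 'i) form set) ext_step D2 C2"
        by blast
      obtain k1 where k1: "k1 \<in> K1" using K1(1) by blast
      \<comment> \<open>Related in \<open>C\<close>, the two names are still related in
        \<open>C2\<close>; as \<open>k1\<close> is committed there, so is \<open>k\<close>.\<close>
      have "(Extn k, Extn k1) \<in> fst C2"
        using K(3)[OF k] k1 \<open>K1 \<subseteq> K\<close> weak_ext_facts(2)[OF C2(1) R(1)] by blast
      moreover have H2: "cHasco C2 = cHasco D \<union> K1" using logeq_Hasco_cHasco[OF C2(2)] HD2 by simp
      ultimately have "k \<in> cHasco C2"
        using sane_class_Hasco[OF weak_ext_facts(1)[OF C2(1) R(1)]] k1 by blast
      then show "k \<in> K1" using H2 H K(2) k by blast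
    qed
    ultimately have "K1 = K" by blast
    \<comment> \<open>With \<open>K\<close> committed nothing external is left to commit, so the
      rest of the match is silent for \<open>cs_step\<close> as well.\<close>
    then have "weak cs_step D2 XTau D'" using weak_ext_facts(4)[OF D1(3) D12(1)] HD2 HD' by simp
    then have "weak cs_step D \<zeta> D'"
      using weak_tauL[OF D1(1) weak_tauR[OF weak_step[of cs_step, OF D1(2)]]] \<open>K1 = K\<close> \<zeta> by blast
    with D'(2) show ?thesis by blast
  qed
  then obtain D' where D': "weak cs_step D \<zeta> D'"
    "logeq (form_Hasco :: ('c, 'e, 'i) form set) ext_step C' D'" by blast
  then show ?thesis
    using weak_cs_facts[OF D'(1) R(2)] CC' R(4) by auto
qed

text \<open>Every extended step is a commit-sensitive step with its label hidden. The match is found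
  for the full label, which \<open>form_Canco\<close> can test, and is then hidden again.\<close>

lemma logeq_Canco_sim:
  assumes R: "sane C" "sane D" "logeq (form_Canco :: ('c, 'e, 'i) form set) (cs_step :: ('c, 'n, 'e) lts) C D"
    "co_eq C = co_eq D" and C': "ext_step C \<zeta> C'"
  shows "\<exists>D'. weak ext_step D \<zeta> D' \<and> sane C' \<and> sane D' \<and>
    logeq (form_Canco :: ('c, 'e, 'i) form set) cs_step C' D' \<and> co_eq C' = co_eq D'"
proof -
  from C' obtain \<eta> where \<eta>: "cs_step C \<eta> C'" "\<zeta> = hide_co \<eta>"
  proof (cases rule: ext_step_cases)
    case 1
    then have "\<zeta> = hide_co \<zeta>" by (cases \<zeta>) auto
    with 1 that show ?thesis by blast
  next
    case (2 K)
    then show ?thesis using that[of "XCo K"] by simp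
  qed
  note CC' = cs_step_facts[OF \<eta>(1) R(1)]
  have co: "K \<noteq> {} \<and> K \<subseteq> cnames C" if "\<eta> = XCo K" for K using CC'(6)[OF that] by blast
  have "\<exists>D'. weak cs_step D \<eta> D' \<and> logeq (form_Canco :: ('c, 'e, 'i) form set) cs_step C' D'"
    using Canco.match_tau[OF R(3)] Canco.match_act[OF R(3,1,2)]
      Canco.match_co[OF form_Canco.intros(5) R(3)] weak_step[of cs_step, OF \<eta>(1)] co
    by (cases \<eta>) auto
  then obtain D' where D': "weak cs_step D \<eta> D'"
    "logeq (form_Canco :: ('c, 'e, 'i) form set) cs_step C' D'" by blast
  then show ?thesis
    using weak_cs_facts[OF D'(1) R(2)] CC' R(4) \<eta>(2) by auto
qed

text \<open>Here formulae yield \<open>co_eq\<close> directly, whereas the relations for the other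
  two fragments carry it as a component.\<close>

lemma logeq_Eq_co_eq:
  assumes "logeq (form_Eq :: ('c, 'e, 'i) form set) (ext_step :: ('c, 'n, 'e) lts) C D"
  shows "co_eq C = co_eq D"
proof -
  have sat: "sat step C (FEq (Nm k) (Nm k') :: ('c, 'e, 'i) form) \<longleftrightarrow> (k, k') \<in> co_eq C"
    for k k' C and step :: "('c, 'n, 'e) lts"
    by (cases C) simp
  have pair: "(k, k') \<in> co_eq C \<longleftrightarrow> (k, k') \<in> co_eq D" if "k \<in> cnames C" "k' \<in> cnames C" for k k'
  proof -
    have "FEq (Nm k) (Nm k') \<in> (form_Eq :: ('c, 'e, 'i) form set)" by (rule form_Eq.intros)
    moreover have "fv (FEq (Nm k) (Nm k') :: ('c, 'e, 'i) form) = {}"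
      "fnames (FEq (Nm k) (Nm k') :: ('c, 'e, 'i) form) \<subseteq> cnames C" using that by auto
    ultimately have "sat ext_step C (FEq (Nm k) (Nm k') :: ('c, 'e, 'i) form) \<longleftrightarrow>
        sat ext_step D (FEq (Nm k) (Nm k') :: ('c, 'e, 'i) form)"
      using assms unfolding logeq_def by blast
    then show ?thesis unfolding sat .
  qed
  have sub: "co_eq C \<subseteq> cnames C \<times> cnames C" for C :: "('c, 'n, 'e) conf"
  proof -
    obtain E H P where C: "C = (E, H, P)" by (cases C)
    have "Hasco H \<subseteq> Htrn H" by (rule subset_trans[OF Hasco_subset_settled settled_subset_Htrn])
    then show ?thesis unfolding C by auto
  qed
  have names: "cnames D = cnames C" using assms by (simp add: logeq_def)
  show ?thesis
  proof (rule set_eqI)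
    fix p :: "'e \<times> 'e"
    obtain k k' where "p = (k, k')" by (cases p)
    then show "p \<in> co_eq C \<longleftrightarrow> p \<in> co_eq D"
      using pair[of k k'] sub[of C] sub[of D] names by auto
  qed
qed

lemma logeq_Eq_sim:
  assumes R: "sane C" "sane D" "logeq (form_Eq :: ('c, 'e, 'i) form set) (ext_step :: ('c, 'n, 'e) lts) C D"
    and C': "ext_step C \<zeta> C'"
  shows "\<exists>D'. weak ext_step D \<zeta> D' \<and> sane C' \<and> sane D' \<and>
    logeq (form_Eq :: ('c, 'e, 'i) form set) ext_step C' D'"
proof -
  have "\<zeta> \<noteq> XCo K" for K using C' by (cases rule: ext_step_cases) auto
  then have "\<exists>D'. weak ext_step D \<zeta> D' \<and> logeq (form_Eq :: ('c, 'e, 'i) form set) ext_step C' D'"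
    using Eq.match_tau[OF R(3)] Eq.match_act[OF R(3,1,2)] weak_step[of ext_step, OF C']
    by (cases \<zeta>) auto
  then show ?thesis using weak_ext_facts(1)[OF _ R(2)] ext_step_sane[OF C' R(1)] by blast
qed

section \<open>From bisimulations to the comparison of the logics\<close>

lemma sane_init: "process P \<Longrightarrow> ftn P \<subseteq> range Intn \<Longrightarrow> sane ({}, Map.empty, P)"
  by (auto simp: sane.simps xconf.simps settled_def Htrn_def Hasco_def equiv_def refl_on_def sym_def trans_def)

text \<open>The initial histories are empty, so equal theories give \<open>logeq\<close> at the
  start. The bisimulation then yields agreement on all formulae, also on those with names outside
  the history.\<close>

lemma Canco_le_Hasco: "(L_Canco :: ('c, 'n, 'e, 'i) logic) \<preceq> L_Hasco"
  unfolding logic_le_def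
proof (intro allI impI, elim conjE)
  fix P Q :: "('c, 'n, 'e) proc"
  assume P: "process P" "ftn P \<subseteq> range Intn" and Q: "process Q" "ftn Q \<subseteq> range Intn"
    and eq: "(L_Hasco P :: ('c, 'e, 'i) form set) = L_Hasco Q"
  have init: "logeq (form_Hasco :: ('c, 'e, 'i) form set) ext_step ({}, Map.empty, P) ({}, Map.empty, Q)"
    using eq unfolding logeq_def L_Hasco_def by auto
  have "sat cs_step ({}, Map.empty, P) \<phi> \<longleftrightarrow> sat cs_step ({}, Map.empty, Q) \<phi>" for \<phi> :: "('c, 'e, 'i) form"
  proof (rule bisimulation_sat[where R="\<lambda>C D. sane C \<and> sane D \<and>
        logeq (form_Hasco :: ('c, 'e, 'i) form set) ext_step C D \<and> co_eq C = co_eq D"], goal_cases)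
    case (1 C D \<zeta> C')
    then show ?case using logeq_Hasco_sim[of C D \<zeta> C'] by blast
  next
    case (2 C D)
    then show ?case by (metis logeq_sym)
  next
    case (3 C D)
    then show ?case by simp
  next
    case 4
    then show ?case by (simp add: sane_init P Q init)
  qed
  then show "(L_Canco P :: ('c, 'e, 'i) form set) = L_Canco Q" unfolding L_Canco_def by simp
qed

lemma Hasco_le_Eq: "(L_Hasco :: ('c, 'n, 'e, 'i) logic) \<preceq> L_Eq"
  unfolding logic_le_def
proof (intro allI impI, elim conjE)
  fix P Q :: "('c, 'n, 'e) proc"
  assume P: "process P" "ftn P \<subseteq> range Intn" and Q: "process Q" "ftn Q \<subseteq> range Intn"
    and eq: "(L_Eq P :: ('c, 'e, 'i) form set) = L_Eq Q"
  have init: "logeq (form_Eq :: ('c, 'e, 'i) form set) ext_step ({}, Map.empty, P) ({}, Map.empty, Q)"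
    using eq unfolding logeq_def L_Eq_def by auto
  have "sat ext_step ({}, Map.empty, P) \<phi> \<longleftrightarrow> sat ext_step ({}, Map.empty, Q) \<phi>" for \<phi> :: "('c, 'e, 'i) form"
  proof (rule bisimulation_sat[where R="\<lambda>C D. sane C \<and> sane D \<and>
        logeq (form_Eq :: ('c, 'e, 'i) form set) ext_step C D"], goal_cases)
    case (1 C D \<zeta> C')
    then show ?case using logeq_Eq_sim[of C D \<zeta> C'] by blast
  next
    case (2 C D)
    then show ?case by (metis logeq_sym)
  next
    case (3 C D)
    then show ?case by (simp add: logeq_Eq_co_eq)
  next
    case 4
    then show ?case by (simp add: sane_init P Q init)
  qed
  then show "(L_Hasco P :: ('c, 'e, 'i) form set) = L_Hasco Q" unfolding L_Hasco_def by simp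
qed

lemma Eq_le_Canco: "(L_Eq :: ('c, 'n, 'e, 'i) logic) \<preceq> L_Canco"
  unfolding logic_le_def
proof (intro allI impI, elim conjE)
  fix P Q :: "('c, 'n, 'e) proc"
  assume P: "process P" "ftn P \<subseteq> range Intn" and Q: "process Q" "ftn Q \<subseteq> range Intn"
    and eq: "(L_Canco P :: ('c, 'e, 'i) form set) = L_Canco Q"
  have init: "logeq (form_Canco :: ('c, 'e, 'i) form set) cs_step ({}, Map.empty, P) ({}, Map.empty, Q)"
    using eq unfolding logeq_def L_Canco_def by auto
  have "sat ext_step ({}, Map.empty, P) \<phi> \<longleftrightarrow> sat ext_step ({}, Map.empty, Q) \<phi>" for \<phi> :: "('c, 'e, 'i) form"
  proof (rule bisimulation_sat[where R="\<lambda>C D. sane C \<and> sane D \<and>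
        logeq (form_Canco :: ('c, 'e, 'i) form set) cs_step C D \<and> co_eq C = co_eq D"], goal_cases)
    case (1 C D \<zeta> C')
    then show ?case using logeq_Canco_sim[of C D \<zeta> C'] by blast
  next
    case (2 C D)
    then show ?case by (metis logeq_sym)
  next
    case (3 C D)
    then show ?case by simp
  next
    case 4
    then show ?case by (simp add: sane_init P Q init)
  qed
  then show "(L_Eq P :: ('c, 'e, 'i) form set) = L_Eq Q" unfolding L_Eq_def by simp
qed

end

theorem theorem5p6:
  assumes index_large: "\<exists>f :: ('c::infinite, 'n::infinite, 'e::infinite) conf \<Rightarrow> 'i. inj f"
  shows "(L_Canco :: ('c, 'n, 'e, 'i) logic) \<preceq> L_Hasco \<and>
         (L_Hasco :: ('c, 'n, 'e, 'i) logic) \<preceq> L_Eq \<and>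
         (L_Eq :: ('c, 'n, 'e, 'i) logic) \<preceq> L_Canco"
proof -
  from index_large obtain f :: "('c, 'n, 'e) conf \<Rightarrow> 'i" where "inj f" ..
  then show ?thesis using Canco_le_Hasco Hasco_le_Eq Eq_le_Canco by blast
qed

end
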